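(* Let $g\in\mathcal{C}(\overline{\mathbb{D}})$ be given, and let $\psi:\mathbb{T}\to\mathbb{C}$ be a bounded integrable function. If $f\in\mathcal{C}^{2}(\mathbb{D})$ satisfies $\Delta f=g$ and $f|_{\mathbb{T}}=\psi\in L^{1}(\mathbb{T})$, then, for $z\in\overline{\mathbb{D}}$, $$\left|f(z)-\frac{1}{2\pi}\,\frac{1-|z|^{2}}{1+|z|^{2}}\int_{0}^{2\pi}\psi(e^{it})\,dt\right|\leq\frac{4\|\mathcal{P}_{\psi}\|_{\infty}}{\pi}\arctan|z|+\frac{\|g\|_{\infty}}{4}(1-|z|^{2}).$$ If we take $g(z)=-4M$ and $f(z)=M(1-|z|^{2})$ for $z\in\overline{\mathbb{D}}$, where $M$ is a positive constant, then this inequality is sharp in $\mathbb{T}\cup\{0\}$.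
   Context: $\mathbb{D}=\{z\in\mathbb{C}:|z|<1\}$ is the open unit disk, $\overline{\mathbb{D}}$ its closure and $\mathbb{T}=\partial\mathbb{D}$. $\mathcal{C}(\overline{\mathbb{D}})$ is the set of continuous complex-valued functions on $\overline{\mathbb{D}}$, and $\mathcal{C}^{2}(\mathbb{D})$ is the set of complex-valued twice continuously differentiable functions on $\mathbb{D}$. For $z=x+iy$, $\Delta f=f_{xx}+f_{yy}$. The Poisson integral of $\psi$ is $$\mathcal{P}_{\psi}(z)=\frac{1}{2\pi}\int_{0}^{2\pi}P(z,e^{it})\psi(e^{it})\,dt,\qquad P(z,e^{it})=\frac{1-|z|^{2}}{|1-ze^{-it}|^{2}},\quad z\in\mathbb{D},$$ and $$\mathcal{G}_{g}(z)=\frac{1}{2\pi}\int_{\mathbb{D}}G(z,w)g(w)\,dA(w),\qquad G(z,w)=\log\left|\frac{1-z\overline{w}}{z-w}\right|,$$ where $dA$ is Lebesgue area measure on $\mathbb{D}$. The solution of $\Delta f=g$ in $\mathbb{D}$ with boundary condition $f|_{\mathbb{T}}=\psi$ is understood to be the one given by $f(z)=\mathcal{P}_{\psi}(z)-\mathcal{G}_{g}(z)$ for $z\in\mathbb{D}$. Norms: $\|\mathcal{P}_{\psi}\|_{\infty}=\sup_{z\in\mathbb{D}}|\mathcal{P}_{\psi}(z)|$ and $\|g\|_{\infty}=\sup_{z\in\mathbb{D}}|g(z)|$.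
   Formalization: For z on the unit circle the inequality is proved for almost every z, and for every z at which f(z) is the radial limit of f, not for every z: it fails at the point when ψ is the indicator of one point, f=ψ on the circle, f=0 in the disk and g=0. *)

theory Defs
  imports "HOL-Analysis.Analysis"
begin

definition poisson_kernel :: "complex \<Rightarrow> complex \<Rightarrow> real" where
  "poisson_kernel z \<zeta> = (1 - (cmod z)\<^sup>2) / (cmod (1 - z * cnj \<zeta>))\<^sup>2"

definition poisson :: "(complex \<Rightarrow> complex) \<Rightarrow> complex \<Rightarrow> complex" where
  "poisson \<psi> z = complex_of_real (1 / (2 * pi)) *
     (LINT t:{0..2*pi}|lebesgue. complex_of_real (poisson_kernel z (cis t)) * \<psi> (cis t))"

definition green_kernel :: "complex \<Rightarrow> complex \<Rightarrow> real" where
  "green_kernel z w = ln (cmod ((1 - z * cnj w) / (z - w)))"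

definition green :: "(complex \<Rightarrow> complex) \<Rightarrow> complex \<Rightarrow> complex" where
  "green g z = complex_of_real (1 / (2 * pi)) *
     (LINT w:ball 0 1|lebesgue. complex_of_real (green_kernel z w) * g w)"

text \<open>Real partial derivatives: direction \<open>1\<close> is \<open>x\<close> and direction \<open>\<i>\<close> is \<open>y\<close>.
  The regularity predicates below are meant for open sets \<open>S\<close>.\<close>

definition partial_deriv :: "complex \<Rightarrow> (complex \<Rightarrow> complex) \<Rightarrow> complex \<Rightarrow> complex" where
  "partial_deriv v f z = vector_derivative (\<lambda>t::real. f (z + t *\<^sub>R v)) (at 0)"

definition C1_on :: "complex set \<Rightarrow> (complex \<Rightarrow> complex) \<Rightarrow> bool" where
  "C1_on S f \<longleftrightarrow> (\<forall>v\<in>{1, \<i>}.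
     (\<forall>z\<in>S. (\<lambda>t::real. f (z + t *\<^sub>R v)) differentiable (at 0)) \<and>
     continuous_on S (partial_deriv v f))"

definition C2_on :: "complex set \<Rightarrow> (complex \<Rightarrow> complex) \<Rightarrow> bool" where
  "C2_on S f \<longleftrightarrow> C1_on S f \<and> (\<forall>v\<in>{1, \<i>}. C1_on S (partial_deriv v f))"

definition laplacian :: "(complex \<Rightarrow> complex) \<Rightarrow> complex \<Rightarrow> complex" where
  "laplacian f z = partial_deriv 1 (partial_deriv 1 f) z + partial_deriv \<i> (partial_deriv \<i> f) z"

definition bounded_boundary_data :: "(complex \<Rightarrow> complex) \<Rightarrow> bool" where
  "bounded_boundary_data \<psi> \<longleftrightarrow>
     bounded (\<psi> ` sphere 0 1) \<and> set_integrable lebesgue {0..2*pi} (\<lambda>t. \<psi> (cis t))"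

text \<open>The solution of the Dirichlet problem is by convention the one given by the
  Poisson--Green representation. The boundary condition is an equality in \<open>L\<^sup>1\<close> of the
  circle, that is, almost everywhere.\<close>

definition dirichlet_solution ::
  "(complex \<Rightarrow> complex) \<Rightarrow> (complex \<Rightarrow> complex) \<Rightarrow> (complex \<Rightarrow> complex) \<Rightarrow> bool" where
  "dirichlet_solution f g \<psi> \<longleftrightarrow>
     C2_on (ball 0 1) f \<and>
     (\<forall>z\<in>ball 0 1. laplacian f z = g z) \<and>
     (AE t\<in>{0..2*pi} in lebesgue. f (cis t) = \<psi> (cis t)) \<and>
     (\<forall>z\<in>ball 0 1. f z = poisson \<psi> z - green g z)"

text \<open>Only used for functions that are bounded on the disk; otherwise the real supremum
  is unspecified.\<close>

definition disk_norm :: "(complex \<Rightarrow> complex) \<Rightarrow> real" where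
  "disk_norm h = (SUP z\<in>ball 0 1. cmod (h z))"

definition schwarz_lhs :: "(complex \<Rightarrow> complex) \<Rightarrow> (complex \<Rightarrow> complex) \<Rightarrow> complex \<Rightarrow> real" where
  "schwarz_lhs f \<psi> z = cmod (f z -
     complex_of_real (1 / (2 * pi) * ((1 - (cmod z)\<^sup>2) / (1 + (cmod z)\<^sup>2))) *
       (LINT t:{0..2*pi}|lebesgue. \<psi> (cis t)))"

definition schwarz_rhs :: "(complex \<Rightarrow> complex) \<Rightarrow> (complex \<Rightarrow> complex) \<Rightarrow> complex \<Rightarrow> real" where
  "schwarz_rhs \<psi> g z = 4 * disk_norm (poisson \<psi>) / pi * arctan (cmod z)
     + disk_norm g / 4 * (1 - (cmod z)\<^sup>2)"

end

theory Submission
  imports Defs "HOL-Complex_Analysis.Cauchy_Integral_Formula"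
begin

text \<open>
  Write \<open>q = (1 - |z|\<^sup>2) / (1 + |z|\<^sup>2)\<close> and let \<open>C\<close> be the supremum of the Poisson integral of \<open>\<psi>\<close>
  on the disk. The Poisson part is the integral of \<open>(P(z, e\<^sup>i\<^sup>t) - q) \<psi>\<close>, and \<open>|P - q|\<close> has mean value
  \<open>4 / \<pi> arctan |z|\<close>, so it suffices that \<open>|\<psi>| \<le> C\<close> almost everywhere. Instead of Fatou's theorem on
  radial limits this uses duality: by Fubini and the symmetry of the kernel, the pairing of \<open>\<psi>\<close> with the
  Poisson integral of a Lipschitz function \<open>\<phi>\<close> at radius \<open>\<rho>\<close> is at most \<open>C\<close> times the \<open>L\<^sup>1\<close> norm of \<open>\<phi>\<close>;
  letting \<open>\<rho> \<rightarrow> 1\<close> and approximating indicators of closed sets by Lipschitz functions bounds every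
  average of \<open>\<psi>\<close> by \<open>C\<close>.

  For the Green part, rotation invariance of the area measure and the mean value property of
  \<open>log |1 - a w|\<close> replace \<open>G(z, w)\<close> by \<open>- log (max |z| |w|)\<close>, whose area integral is
  \<open>\<pi> / 2 (1 - |z|\<^sup>2)\<close>.
\<close>

section \<open>The Poisson kernel\<close>

lemma poisson_kernel_nonneg:
  assumes "cmod z < 1"
  shows "0 \<le> poisson_kernel z \<zeta>"
  using assms by (auto simp: poisson_kernel_def power_le_one abs_square_le_1)

text \<open>Serves two purposes: the denominator of the kernel never vanishes on the circle, and the
  principal logarithm \<open>Ln (1 - z * cnj \<zeta>)\<close> stays away from its branch
  cut.\<close>

lemma one_minus_mult_cnj_in_right_half_plane:
  assumes "cmod z < 1" "cmod \<zeta> = 1"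
  shows "0 < Re (1 - z * cnj \<zeta>)"
proof -
  have "Re (z * cnj \<zeta>) \<le> cmod (z * cnj \<zeta>)" by (rule complex_Re_le_cmod)
  also have "\<dots> < 1" using assms by (simp add: norm_mult)
  finally show ?thesis by simp
qed

text \<open>Multiplying numerator and denominator by the conjugate of the denominator gives the
  kernel in the form that arises when the antiderivative is differentiated.\<close>

lemma poisson_kernel_eq_Re:
  assumes "cmod z < 1" "cmod \<zeta> = 1"
  shows "poisson_kernel z \<zeta> = Re ((1 + z * cnj \<zeta>) / (1 - z * cnj \<zeta>))"
proof -
  define w where "w = z * cnj \<zeta>"
  have w: "cmod w = cmod z" using assms by (simp add: w_def norm_mult)
  have "Re ((1 + w) / (1 - w)) = (1 - (cmod w)\<^sup>2) / (cmod (1 - w))\<^sup>2"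
    unfolding Re_divide cmod_power2 by (simp add: power2_eq_square algebra_simps)
  then show ?thesis by (simp add: poisson_kernel_def w flip: w_def)
qed

text \<open>With \<open>w = z * cis (- t)\<close>, the derivative of \<open>Ln (1 - w)\<close> in t
  is \<open>\<i> * w / (1 - w)\<close>, whose imaginary part is \<open>Re (w / (1 - w))\<close>.
  Since \<open>1 + 2 * (w / (1 - w)) = (1 + w) / (1 - w)\<close>, twice this part plus 1 is the
  kernel.\<close>

lemma poisson_kernel_antiderivative:
  assumes "cmod z < 1"
  shows "((\<lambda>t. t + 2 * Im (Ln (1 - z * cis (- t)))) has_real_derivative poisson_kernel z (cis t))
           (at t within S)"
proof -
  define w where "w = z * cis (- t)"
  have pos: "0 < Re (1 - z * cis (- t))"
    using one_minus_mult_cnj_in_right_half_plane[OF assms, of "cis t"] by (simp add: cis_cnj)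
  then have nz: "1 - w \<noteq> 0" by (metis w_def order_less_irrefl zero_complex.simps(1))
  have nonpos: "1 - z * cis (- t) \<notin> \<real>\<^sub>\<le>\<^sub>0"
    using pos by (auto simp: complex_nonpos_Reals_iff)
  \<comment> \<open>The complex derivative of the exponential is taken first and then restricted to
    real parameters.\<close>
  have "((\<lambda>u. 1 - z * exp (- \<i> * u)) has_field_derivative
           (\<i> * (z * exp (- \<i> * complex_of_real t)))) (at (complex_of_real t))"
    by (auto intro!: derivative_eq_intros)
  from has_vector_derivative_real_field[OF this]
  have "((\<lambda>t. 1 - z * exp (\<i> * complex_of_real (- t))) has_vector_derivative
           (\<i> * (z * exp (\<i> * complex_of_real (- t))))) (at t within S)"
    by simp
  then have "((\<lambda>t. 1 - z * cis (- t)) has_vector_derivative (\<i> * w)) (at t within S)"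
    by (simp add: w_def cis_conv_exp)
  from field_vector_diff_chain_within[OF this has_field_derivative_at_within[OF has_field_derivative_Ln[OF nonpos]]]
  have "((\<lambda>t. Ln (1 - z * cis (- t))) has_vector_derivative (\<i> * w / (1 - w))) (at t within S)"
    by (simp add: o_def w_def field_simps)
  from bounded_linear.has_vector_derivative[OF bounded_linear_Im this]
  have "((\<lambda>t. Im (Ln (1 - z * cis (- t)))) has_vector_derivative Im (\<i> * w / (1 - w))) (at t within S)" .
  then have "((\<lambda>t. Im (Ln (1 - z * cis (- t)))) has_real_derivative Re (w / (1 - w))) (at t within S)"
    by (simp add: has_real_derivative_iff_has_vector_derivative flip: times_divide_eq_right)
  then have "((\<lambda>t. t + 2 * Im (Ln (1 - z * cis (- t)))) has_real_derivative 1 + 2 * Re (w / (1 - w))) (at t within S)"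
    by (intro DERIV_add DERIV_ident DERIV_cmult)
  also have "1 + 2 * Re (w / (1 - w)) = Re (1 + 2 * (w / (1 - w)))"
    by (simp del: times_divide_eq_right)
  also have "1 + 2 * (w / (1 - w)) = (1 + w) / (1 - w)" using nz by (simp add: field_simps)
  also have "Re \<dots> = poisson_kernel z (cis t)"
    using assms by (simp add: poisson_kernel_eq_Re w_def cis_cnj)
  finally show ?thesis .
qed

lemma continuous_on_poisson_kernel_cis:
  assumes "cmod z < 1"
  shows "continuous_on S (\<lambda>t. poisson_kernel z (cis t))"
proof -
  have "1 - z * cnj (cis t) \<noteq> 0" for t
    using one_minus_mult_cnj_in_right_half_plane[OF assms, of "cis t"] by (metis norm_cis order_less_irrefl zero_complex.simps(1))
  then show ?thesis unfolding poisson_kernel_def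
    by (intro continuous_intros) auto
qed

lemma has_integral_poisson_kernel:
  assumes "cmod z < 1" "a \<le> b"
  shows "((\<lambda>t. poisson_kernel z (cis t)) has_integral
           (b - a + 2 * (Im (Ln (1 - z * cis (- b))) - Im (Ln (1 - z * cis (- a)))))) {a..b}"
proof -
  have "((\<lambda>t. poisson_kernel z (cis t)) has_integral
     (b + 2 * Im (Ln (1 - z * cis (- b)))) - (a + 2 * Im (Ln (1 - z * cis (- a))))) {a..b}"
    by (rule fundamental_theorem_of_calculus[OF \<open>a \<le> b\<close>])
       (metis assms(1) has_real_derivative_iff_has_vector_derivative poisson_kernel_antiderivative)
  then show ?thesis by (simp add: algebra_simps)
qed

text \<open>Over a full period the logarithmic terms of the antiderivative agree at the two ends and
  cancel.\<close>

lemma has_integral_poisson_kernel_circle: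
  assumes "cmod z < 1"
  shows "((\<lambda>t. poisson_kernel z (cis t)) has_integral 2 * pi) {0..2*pi}"
  using has_integral_poisson_kernel[OF assms, of 0 "2*pi"] by (simp flip: cis_cnj)

section \<open>Mean deviation of the kernel from its level on the orthogonal diameter\<close>

text \<open>The deviation is integrated over a period that starts at a crossing point; the piece
  beyond p is moved back by one period to fill the gap before a.\<close>

lemma has_integral_periodic_shift:
  fixes f :: "real \<Rightarrow> real"
  assumes per: "\<And>t. f (t + p) = f t" and a: "0 \<le> a" "a \<le> p"
    and f: "(f has_integral I) {a..a+p}"
  shows "(f has_integral I) {0..p}"
proof -
  have int: "f integrable_on {a..p}" "f integrable_on {p..a+p}"
    using a by (auto intro!: integrable_on_subinterval[OF has_integral_integrable[OF f]])
  then have I: "I = integral {a..p} f + integral {p..a+p} f"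
    using has_integral_combine[of a p "a+p" f] a f
    by (metis add_increasing2 has_integral_unique integrable_integral order_refl add.commute le_add_same_cancel1)
  have "((\<lambda>x. f (x + p)) has_integral integral {p..a+p} f) {0..a}"
    using has_integral_shift_real_ivl[of f "integral {p..a+p} f" p "a+p" p] int(2)
    by (simp add: integrable_integral)
  then have "(f has_integral integral {p..a+p} f) {0..a}" by (simp add: per)
  from has_integral_combine[OF a this integrable_integral[OF int(1)]] I
  show ?thesis by (simp add: add.commute)
qed

text \<open>Evaluates the antiderivative at the crossing points, where
  \<open>1 - z * cis (- t)\<close> has real part 1 and imaginary part plus or minus |z|.\<close>

lemma Im_Ln_1_plus_ii: "Im (Ln (1 + \<i> * complex_of_real x)) = arctan x"
  by (subst Im_Ln_eq) (auto simp: complex_eq_iff)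

text \<open>The kernel crosses the level \<open>(1 - |z|\<^sup>2) / (1 + |z|\<^sup>2)\<close> exactly where \<open>z\<close> and \<open>\<zeta>\<close> are
  orthogonal, so the integral splits into two half circles.\<close>

lemma has_integral_poisson_kernel_deviation:
  assumes "cmod z < 1"
  defines "q \<equiv> (1 - (cmod z)\<^sup>2) / (1 + (cmod z)\<^sup>2)"
  shows "((\<lambda>t. \<bar>poisson_kernel z (cis t) - q\<bar>) has_integral 8 * arctan (cmod z)) {0..2*pi}"
proof -
  define r where "r = cmod z"
  \<comment> \<open>The angle a lies a quarter turn before the argument of z, so the half circle
    from a to a + pi is centred at the direction of z. For z = 0 any angle would do.\<close>
  define a where "a = Arg2pi (- \<i> * z)"
  have a: "0 \<le> a" "a \<le> 2 * pi"
    using Arg2pi[of "- \<i> * z"] by (auto simp: a_def)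
  have r: "0 \<le> r" "r < 1" using assms by (auto simp: r_def)
  have "- \<i> * z = r * cis a"
    using Arg2pi_eq[of "- \<i> * z"] by (simp add: a_def r_def norm_mult cis_conv_exp)
  then have z: "z = \<i> * (r * cis a)"
    by (metis (no_types, lifting) minus_mult_minus mult.assoc mult.left_neutral mult_minus_left i_squared power2_i power2_eq_square minus_minus)
  have sq: "(1 + r * x)\<^sup>2 + (r * y)\<^sup>2 = 1 + r\<^sup>2 * (x\<^sup>2 + y\<^sup>2) + 2 * r * x" for x y
    by algebra
  \<comment> \<open>In these coordinates q is the value at a zero of the sine, and the sign of
    \<open>sin (t - a)\<close> decides on which side of q the kernel lies.\<close>
  have Pker: "poisson_kernel z (cis t) = (1 - r\<^sup>2) / (1 + r\<^sup>2 - 2 * r * sin (t - a))" for t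
  proof -
    have "z * cnj (cis t) = \<i> * r * cis (a - t)"
      by (simp add: z cis_cnj cis_mult)
    then have "(cmod (1 - z * cnj (cis t)))\<^sup>2 = (1 + r * sin (a - t))\<^sup>2 + (r * cos (a - t))\<^sup>2"
      by (simp add: cmod_power2)
    also have "\<dots> = 1 + r\<^sup>2 * ((sin (a - t))\<^sup>2 + (cos (a - t))\<^sup>2) + 2 * r * sin (a - t)"
      by (rule sq)
    also have "\<dots> = 1 + r\<^sup>2 - 2 * r * sin (t - a)"
      using sin_minus[of "t - a"] by (simp only: sin_cos_squared_add) simp
    finally show ?thesis by (simp add: poisson_kernel_def r_def)
  qed
  have r2: "r\<^sup>2 < 1" using r by (simp add: abs_square_less_1)
  have denom: "0 < 1 + r\<^sup>2 - 2 * r * sin (t - a)" for t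
  proof -
    have "2 * r * sin (t - a) \<le> 2 * r" using r by (simp add: mult_left_le)
    moreover have "0 < (1 - r)\<^sup>2" using r by simp
    ultimately show ?thesis by (simp add: power2_eq_square algebra_simps)
  qed
  have ge: "q \<le> poisson_kernel z (cis t)" if "t \<in> {a..a+pi}" for t
  proof -
    have "0 \<le> sin (t - a)" using that by (intro sin_ge_zero) auto
    then show ?thesis unfolding Pker q_def r_def[symmetric]
      using r r2 by (intro divide_left_mono mult_pos_pos denom) (auto intro: add_pos_nonneg)
  qed
  have le: "poisson_kernel z (cis t) \<le> q" if "t \<in> {a+pi..a+2*pi}" for t
  proof -
    have "sin (t - a) \<le> 0" using that
      using sin_ge_zero[of "t - a - pi"] by (auto simp: sin_diff)
    then have "1 + r\<^sup>2 \<le> 1 + r\<^sup>2 - 2 * r * sin (t - a)" using r by (simp add: mult_nonneg_nonpos)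
    then show ?thesis unfolding Pker q_def r_def[symmetric]
      using r r2 by (intro divide_left_mono mult_pos_pos denom) (auto intro: add_pos_nonneg)
  qed
  \<comment> \<open>At the three division points the argument of the logarithm has real part 1, so
    the antiderivative reduces to arctangents of plus or minus r.\<close>
  have z1: "1 - z * cis (- a) = 1 + \<i> * complex_of_real (- r)"
    by (simp add: z cis_mult)
  have z2: "1 - z * cis (- (a + pi)) = 1 + \<i> * complex_of_real r"
    by (simp add: z mult.assoc cis_mult) (simp flip: cis_cnj)
  have z3: "1 - z * cis (- (a + 2*pi)) = 1 + \<i> * complex_of_real (- r)"
    by (simp add: z mult.assoc cis_mult) (simp flip: cis_cnj)
  have "((\<lambda>t. poisson_kernel z (cis t) - q) has_integral (pi + 4 * arctan r - pi * q)) {a..a+pi}"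
    using has_integral_diff[OF has_integral_poisson_kernel[OF assms(1), of a "a+pi"] has_integral_const_real[of q a "a+pi"]]
    unfolding z1 z2 Im_Ln_1_plus_ii by (simp add: arctan_minus algebra_simps)
  then have 1: "((\<lambda>t. \<bar>poisson_kernel z (cis t) - q\<bar>) has_integral (pi + 4 * arctan r - pi * q)) {a..a+pi}"
    by (rule has_integral_eq[rotated]) (use ge in auto)
  have "((\<lambda>t. q - poisson_kernel z (cis t)) has_integral (pi * q - (pi - 4 * arctan r))) {a+pi..a+2*pi}"
    using has_integral_diff[OF has_integral_const_real[of q "a+pi" "a+2*pi"] has_integral_poisson_kernel[OF assms(1), of "a+pi" "a+2*pi"] ]
    unfolding z2 z3 Im_Ln_1_plus_ii by (simp add: arctan_minus algebra_simps)
  then have 2: "((\<lambda>t. \<bar>poisson_kernel z (cis t) - q\<bar>) has_integral (pi * q - (pi - 4 * arctan r))) {a+pi..a+2*pi}"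
    by (rule has_integral_eq[rotated]) (use le in auto)
  \<comment> \<open>Both halves have length pi, so the terms pi and \<open>pi * q\<close> cancel and
    only the two arctangent contributions remain.\<close>
  have "((\<lambda>t. \<bar>poisson_kernel z (cis t) - q\<bar>) has_integral 8 * arctan r) {a..a+2*pi}"
    using has_integral_combine[OF _ _ 1 2] by simp
  then show ?thesis unfolding r_def
    by (intro has_integral_periodic_shift[OF _ a]) (auto simp flip: cis_mult)
qed

section \<open>Boundary values and the Poisson integral\<close>

abbreviation (input) circ :: "real measure" where
  "circ \<equiv> lebesgue_on {0..2*pi}"

lemma finite_measure_circ: "finite_measure circ"
  by (intro finite_measureI) (simp add: emeasure_restrict_space)

lemma measure_circ: "measure circ (space circ) = 2 * pi"
  by (simp add: measure_restrict_space)

lemma borel_measurable_continuous_circ: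
  "continuous_on UNIV f \<Longrightarrow> f \<in> borel_measurable circ"
  by (intro measurable_restrict_space1 measurable_completion) (simp add: borel_measurable_continuous_onI)

lemma integral_circ_eq:
  fixes f :: "real \<Rightarrow> 'a :: {banach, second_countable_topology}"
  shows "integral\<^sup>L circ f = (LINT t:{0..2*pi}|lebesgue. f t)"
  by (simp add: integral_restrict_space set_lebesgue_integral_def)

text \<open>Bridge from the gauge integral, in which the explicit values are computed, to the
  Lebesgue integral: continuity on a compact interval gives absolute integrability.\<close>

lemma integral_circ_eqI:
  fixes f :: "real \<Rightarrow> real"
  assumes "continuous_on UNIV f" "(f has_integral I) {0..2*pi}"
  shows "integrable circ f" "integral\<^sup>L circ f = I"
proof -
  have "f absolutely_integrable_on {0..2*pi}"
    using assms(1) by (intro absolutely_integrable_continuous_real continuous_on_subset[OF assms(1)]) auto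
  then have *: "set_integrable lebesgue {0..2*pi} f" .
  then show "integrable circ f"
    by (simp add: integrable_restrict_space set_integrable_def)
  show "integral\<^sup>L circ f = I"
    using set_lebesgue_integral_eq_integral(2)[OF *] assms(2) unfolding integral_circ_eq by (metis integral_unique)
qed

lemma integral_poisson_kernel:
  assumes "cmod z < 1"
  shows "integrable circ (\<lambda>t. poisson_kernel z (cis t))"
    "integral\<^sup>L circ (\<lambda>t. poisson_kernel z (cis t)) = 2 * pi"
  using integral_circ_eqI[OF continuous_on_poisson_kernel_cis has_integral_poisson_kernel_circle] assms by blast+

lemma integral_poisson_kernel_deviation:
  assumes "cmod z < 1"
  defines "q \<equiv> (1 - (cmod z)\<^sup>2) / (1 + (cmod z)\<^sup>2)"
  shows "integrable circ (\<lambda>t. \<bar>poisson_kernel z (cis t) - q\<bar>)"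
    "(\<integral>t. \<bar>poisson_kernel z (cis t) - q\<bar> \<partial>circ) = 8 * arctan (cmod z)"
  using has_integral_poisson_kernel_deviation[OF assms(1)] unfolding q_def
  by (intro integral_circ_eqI; auto intro!: continuous_intros continuous_on_poisson_kernel_cis assms)+

section \<open>Convergence of Poisson means of Lipschitz functions\<close>

text \<open>The two denominators are moduli of conjugate numbers. This symmetry makes Poisson
  extension to a fixed radius self-adjoint on the circle.\<close>

lemma poisson_kernel_scale_commute:
  assumes "cmod \<xi> = cmod \<zeta>"
  shows "poisson_kernel (complex_of_real \<rho> * \<xi>) \<zeta> = poisson_kernel (complex_of_real \<rho> * \<zeta>) \<xi>"
proof -
  have "1 - complex_of_real \<rho> * \<zeta> * cnj \<xi> = cnj (1 - complex_of_real \<rho> * \<xi> * cnj \<zeta>)" by (simp add: mult_ac)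
  then show ?thesis
    using assms by (simp only: poisson_kernel_def complex_mod_cnj norm_mult)
qed

text \<open>The denominator is the square of d = |\<zeta> - \<rho> \<xi>|, and d is at least 1 -
  \<rho>. Hence |\<zeta> - \<xi>| is at most d + (1 - \<rho>), so at most 2 d, and the singularity
  is absorbed at the cost of a factor 4.\<close>

lemma poisson_kernel_dist_bound:
  assumes "0 \<le> \<rho>" "\<rho> < 1" "cmod \<xi> = 1" "cmod \<zeta> = 1"
  shows "poisson_kernel (complex_of_real \<rho> * \<xi>) \<zeta> * (cmod (\<zeta> - \<xi>))\<^sup>2 \<le> 4 * (1 - \<rho>\<^sup>2)"
proof -
  have "\<zeta> * cnj \<zeta> = 1" using assms by (simp add: complex_norm_square[symmetric])
  then have "cmod (1 - \<rho> * \<xi> * cnj \<zeta>) = cmod ((\<zeta> - \<rho> * \<xi>) * cnj \<zeta>)" by (simp add: algebra_simps)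
  then have d: "cmod (1 - \<rho> * \<xi> * cnj \<zeta>) = cmod (\<zeta> - \<rho> * \<xi>)" (is "_ = ?d") using assms by (simp add: norm_mult)
  have "1 - \<rho> \<le> ?d"
    using norm_triangle_ineq2[of \<zeta> "\<rho> * \<xi>"] assms by (simp add: norm_mult)
  moreover have "cmod (\<rho> * \<xi> - \<xi>) = 1 - \<rho>"
  proof -
    have "\<rho> * \<xi> - \<xi> = complex_of_real (\<rho> - 1) * \<xi>" by (simp add: algebra_simps)
    then show ?thesis using assms by (simp only: norm_mult norm_of_real) simp
  qed
  ultimately have "cmod (\<zeta> - \<xi>) \<le> 2 * ?d" and pos: "0 < ?d"
    using norm_triangle_ineq[of "\<zeta> - \<rho> * \<xi>" "\<rho> * \<xi> - \<xi>"] assms by auto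
  then have "(cmod (\<zeta> - \<xi>))\<^sup>2 \<le> (2 * ?d)\<^sup>2" by (intro power_mono) auto
  moreover have r2: "\<rho>\<^sup>2 \<le> 1" using assms by (simp add: power_le_one)
  ultimately have le: "(1 - \<rho>\<^sup>2) * (cmod (\<zeta> - \<xi>))\<^sup>2 \<le> (1 - \<rho>\<^sup>2) * (4 * ?d\<^sup>2)"
    by (intro mult_left_mono) (auto simp: power_mult_distrib)
  have P: "poisson_kernel (complex_of_real \<rho> * \<xi>) \<zeta> = (1 - \<rho>\<^sup>2) / ?d\<^sup>2"
    unfolding poisson_kernel_def d using assms by (simp add: norm_mult)
  have d2: "0 < ?d\<^sup>2" using pos by simp
  show ?thesis unfolding P times_divide_eq_left pos_divide_le_eq[OF d2] using le by (simp only: mult_ac)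
qed

text \<open>For Lipschitz data, \<open>L d \<le> s + L\<^sup>2 d\<^sup>2 / (4 s)\<close> with \<open>s = sqrt (1 - \<rho>\<^sup>2)\<close> turns the previous
  bound into a uniform rate of convergence.\<close>

lemma poisson_radial_error:
  fixes \<phi> :: "complex \<Rightarrow> real"
  assumes \<phi>: "L-lipschitz_on UNIV \<phi>" and \<rho>: "0 \<le> \<rho>" "\<rho> < 1" and \<xi>: "cmod \<xi> = 1"
  shows "\<bar>(\<integral>t. poisson_kernel (complex_of_real \<rho> * \<xi>) (cis t) * \<phi> (cis t) \<partial>circ) - 2 * pi * \<phi> \<xi>\<bar>
           \<le> 2 * pi * ((1 + L\<^sup>2) * sqrt (1 - \<rho>\<^sup>2))"
proof -
  interpret finite_measure circ by (rule finite_measure_circ)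
  define s where "s = sqrt (1 - \<rho>\<^sup>2)"
  have r2: "\<rho>\<^sup>2 < 1" using \<rho> by (simp add: abs_square_less_1)
  then have s: "0 < s" "s\<^sup>2 = 1 - \<rho>\<^sup>2" by (auto simp: s_def)
  define P where "P t = poisson_kernel (complex_of_real \<rho> * \<xi>) (cis t)" for t
  have lt1: "cmod (\<rho> * \<xi>) < 1" using \<rho> \<xi> by (simp add: norm_mult)
  have P0: "0 \<le> P t" for t unfolding P_def by (rule poisson_kernel_nonneg[OF lt1])
  have Pi: "integrable circ P" "integral\<^sup>L circ P = 2 * pi"
    using integral_poisson_kernel[OF lt1] by (auto simp: P_def[abs_def])
  have cont: "continuous_on UNIV \<phi>" using \<phi> by (rule lipschitz_on_continuous_on)
  have contP: "continuous_on UNIV P" unfolding P_def[abs_def] by (rule continuous_on_poisson_kernel_cis[OF lt1])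
  have Pf: "integrable circ (\<lambda>t. P t * \<phi> (cis t))"
  proof -
    have "(\<lambda>t. P t * \<phi> (cis t)) integrable_on {0..2*pi}"
      by (intro integrable_continuous_real continuous_intros continuous_on_subset[OF contP]
            continuous_on_compose2[OF cont]) auto
    then show ?thesis
      by (intro integral_circ_eqI(1)[OF _ integrable_integral] continuous_intros contP continuous_on_compose2[OF cont]) auto
  qed
  have bound: "\<bar>P t * \<phi> (cis t) - P t * \<phi> \<xi>\<bar> \<le> P t * s + L\<^sup>2 * s" for t
  proof -
    define d where "d = cmod (cis t - \<xi>)"
    have "\<bar>\<phi> (cis t) - \<phi> \<xi>\<bar> \<le> L * d"
      using lipschitz_onD[OF \<phi>, of "cis t" \<xi>] by (simp add: d_def dist_norm)
    also have "L * d \<le> s + L\<^sup>2 * d\<^sup>2 / (4 * s)"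
    proof -
      have "0 \<le> (2 * s - L * d)\<^sup>2" by simp
      then have "4 * s * (L * d) \<le> 4 * s * s + L\<^sup>2 * d\<^sup>2" by (simp add: power2_eq_square algebra_simps)
      then show ?thesis using s by (simp add: field_simps)
    qed
    finally have "P t * \<bar>\<phi> (cis t) - \<phi> \<xi>\<bar> \<le> P t * (s + L\<^sup>2 * d\<^sup>2 / (4 * s))"
      by (intro mult_left_mono P0)
    also have "\<dots> = P t * s + L\<^sup>2 / (4 * s) * (P t * d\<^sup>2)" by (simp add: field_simps)
    \<comment> \<open>The quadratic term is paired with the kernel bound, whose right-hand side is
      \<open>4 * (1 - \<rho>\<^sup>2)\<close>, that is \<open>4 * s\<^sup>2\<close>.\<close>
    also have "\<dots> \<le> P t * s + L\<^sup>2 / (4 * s) * (4 * s\<^sup>2)"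
      using poisson_kernel_dist_bound[OF \<rho> \<xi>, of "cis t"] s
      by (intro add_left_mono mult_left_mono) (auto simp: P_def d_def)
    also have "\<dots> = P t * s + L\<^sup>2 * s" using s(1) by (simp add: power2_eq_square)
    finally show ?thesis using P0[of t] by (simp add: abs_mult right_diff_distrib[symmetric])
  qed
  \<comment> \<open>As P has total mass 2 pi, the constant moves under the integral.\<close>
  have "(\<integral>t. P t * \<phi> (cis t) \<partial>circ) - 2 * pi * \<phi> \<xi> = (\<integral>t. P t * \<phi> (cis t) - P t * \<phi> \<xi> \<partial>circ)"
    using Pi Pf by simp
  also have "\<bar>\<dots>\<bar> \<le> (\<integral>t. \<bar>P t * \<phi> (cis t) - P t * \<phi> \<xi>\<bar> \<partial>circ)"
    by (rule integral_abs_bound)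
  also have "\<dots> \<le> (\<integral>t. P t * s + L\<^sup>2 * s \<partial>circ)"
    using Pi Pf bound by (intro integral_mono) auto
  also have "\<dots> = 2 * pi * ((1 + L\<^sup>2) * s)"
    using Pi measure_circ by (simp add: algebra_simps)
  finally show ?thesis by (simp add: P_def s_def)
qed

section \<open>Duality between boundary data and Lipschitz test functions\<close>

text \<open>Fubini on the product of two circles, together with the symmetry of the kernel, moves
  the Poisson extension from \<open>\<phi>\<close> to \<open>\<psi>\<close>. The factor 2 pi appears
  because only \<open>poisson\<close> is normalised.\<close>

lemma poisson_integral_pairing:
  fixes \<phi> :: "complex \<Rightarrow> real"
  assumes \<psi>: "integrable circ (\<lambda>t. \<psi> (cis t))" "\<And>t. cmod (\<psi> (cis t)) \<le> B"
    and \<phi>: "continuous_on UNIV \<phi>" and \<rho>: "0 \<le> \<rho>" "\<rho> < 1"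
  shows "integrable circ (\<lambda>s. \<psi> (cis s) * complex_of_real (\<integral>t. poisson_kernel (complex_of_real \<rho> * cis s) (cis t) * \<phi> (cis t) \<partial>circ))"
    and "(\<integral>s. \<psi> (cis s) * complex_of_real (\<integral>t. poisson_kernel (complex_of_real \<rho> * cis s) (cis t) * \<phi> (cis t) \<partial>circ) \<partial>circ)
    = (\<integral>t. complex_of_real (2 * pi) * poisson \<psi> (\<rho> * cis t) * \<phi> (cis t) \<partial>circ)"
proof -
  interpret finite_measure circ by (rule finite_measure_circ)
  interpret pair_sigma_finite circ circ ..
  have lt1: "cmod (\<rho> * cis s) < 1" for s using \<rho> by (simp add: norm_mult)
  define H where "H p = poisson_kernel (complex_of_real \<rho> * cis (fst p)) (cis (snd p)) * \<phi> (cis (snd p))" for p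
  define F where "F p = \<psi> (cis (fst p)) * complex_of_real (H p)" for p
  have contF: "continuous_on UNIV H"
  proof -
    have "1 - complex_of_real \<rho> * cis (fst p) * cnj (cis (snd p)) \<noteq> 0" for p
      using one_minus_mult_cnj_in_right_half_plane[OF lt1, of "cis (snd p)"]
      by (metis norm_cis order_less_irrefl zero_complex.simps(1))
    then show ?thesis unfolding H_def[abs_def] poisson_kernel_def
      by (intro continuous_intros continuous_on_compose2[OF \<phi>]) auto
  qed
  have id[measurable]: "(\<lambda>x. x) \<in> borel_measurable circ"
    by (intro borel_measurable_continuous_circ continuous_intros)
  have intF: "integrable (circ \<Otimes>\<^sub>M circ) F"
  proof -
    \<comment> \<open>The continuous factor H is bounded on the compact square and
      \<open>\<psi>\<close> by B; a bounded measurable function on a finite measure space is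
      integrable.\<close>
    have cpt: "compact (({0..2*pi} \<times> {0..2*pi}) :: (real \<times> real) set)" by (intro compact_Times) auto
    have "compact (H ` ({0..2*pi} \<times> {0..2*pi}))"
      by (intro compact_continuous_image cpt continuous_on_subset[OF contF]) auto
    then have "bounded (H ` ({0..2*pi} \<times> {0..2*pi}))" by (rule compact_imp_bounded)
    then obtain K where "\<forall>x \<in> H ` ({0..2*pi} \<times> {0..2*pi}). norm x \<le> K"
      unfolding bounded_iff by (elim exE)
    then have K: "\<bar>H p\<bar> \<le> K" if "p \<in> {0..2*pi} \<times> {0..2*pi}" for p
      using that by (metis imageI real_norm_def)
    interpret C: finite_measure "circ \<Otimes>\<^sub>M circ"
      by (intro finite_measure_pair_measure finite_measure_circ)
    show ?thesis
    proof (rule C.integrable_const_bound[where B="B * K"])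
      have "cmod (F p) \<le> B * K" if "p \<in> space (circ \<Otimes>\<^sub>M circ)" for p
      proof -
        have "0 \<le> B" using order_trans[OF norm_ge_zero \<psi>(2)[of 0]] .
        then show ?thesis using K[of p] \<psi>(2)[of "fst p"] that
          unfolding F_def norm_mult norm_of_real
          by (intro mult_mono) (auto simp: space_pair_measure)
      qed
      then show "AE p in circ \<Otimes>\<^sub>M circ. cmod (F p) \<le> B * K" by (rule AE_I2)
      have [measurable]: "(\<lambda>t. \<psi> (cis t)) \<in> borel_measurable circ" using \<psi>(1) by auto
      have [measurable]: "H \<in> borel_measurable (circ \<Otimes>\<^sub>M circ)"
      proof -
        have "(\<lambda>p. (fst p, snd p)) \<in> circ \<Otimes>\<^sub>M circ \<rightarrow>\<^sub>M borel \<Otimes>\<^sub>M borel" by measurable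
        from measurable_compose[OF this, of H borel] borel_measurable_continuous_onI[OF contF]
        show ?thesis by (simp add: borel_prod)
      qed
      show "F \<in> borel_measurable (circ \<Otimes>\<^sub>M circ)"
        unfolding F_def[abs_def] by measurable
    qed
  qed
  have inner: "(\<integral>t. F (s, t) \<partial>circ) = \<psi> (cis s) * complex_of_real (\<integral>t. poisson_kernel (complex_of_real \<rho> * cis s) (cis t) * \<phi> (cis t) \<partial>circ)" for s
    unfolding F_def H_def fst_conv snd_conv integral_mult_right_zero integral_complex_of_real ..
  show "integrable circ (\<lambda>s. \<psi> (cis s) * complex_of_real (\<integral>t. poisson_kernel (complex_of_real \<rho> * cis s) (cis t) * \<phi> (cis t) \<partial>circ))"
    using integrable_fst'[OF intF] unfolding inner .
  from Fubini_integral[of "\<lambda>s t. F (s, t)"] intF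
  have "(\<integral>s. (\<integral>t. F (s, t) \<partial>circ) \<partial>circ) = (\<integral>t. (\<integral>s. F (s, t) \<partial>circ) \<partial>circ)" by simp
  also have "(\<lambda>t. \<integral>s. F (s, t) \<partial>circ) = (\<lambda>t. complex_of_real (2 * pi) * poisson \<psi> (\<rho> * cis t) * \<phi> (cis t))"
  proof
    fix t
    have "F (s, t) = complex_of_real (poisson_kernel (\<rho> * cis t) (cis s)) * \<psi> (cis s) * \<phi> (cis t)" for s
      unfolding F_def H_def fst_conv snd_conv
      by (subst poisson_kernel_scale_commute) (simp_all add: mult_ac)
    then show "(\<integral>s. F (s, t) \<partial>circ) = complex_of_real (2 * pi) * poisson \<psi> (\<rho> * cis t) * \<phi> (cis t)"
      by (simp add: poisson_def integral_circ_eq)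
  qed
  finally show "(\<integral>s. \<psi> (cis s) * complex_of_real (\<integral>t. poisson_kernel (complex_of_real \<rho> * cis s) (cis t) * \<phi> (cis t) \<partial>circ) \<partial>circ)
    = (\<integral>t. complex_of_real (2 * pi) * poisson \<psi> (\<rho> * cis t) * \<phi> (cis t) \<partial>circ)"
    unfolding inner .
qed

text \<open>At each radius \<rho> the function \<open>2 * pi * \<phi>\<close> is replaced by its
  unnormalised Poisson integral with a uniform error. By duality the result pairs
  \<open>\<phi>\<close> with \<open>poisson \<psi>\<close> on a circle inside the disk, where C
  applies; then \<rho> tends to 1.\<close>

lemma norm_integral_boundary_le:
  fixes \<phi> :: "complex \<Rightarrow> real"
  assumes \<psi>: "integrable circ (\<lambda>t. \<psi> (cis t))" "\<And>t. cmod (\<psi> (cis t)) \<le> B"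
    and C: "\<And>z. cmod z < 1 \<Longrightarrow> cmod (poisson \<psi> z) \<le> C"
    and \<phi>: "L-lipschitz_on UNIV \<phi>"
  shows "cmod (\<integral>t. \<psi> (cis t) * \<phi> (cis t) \<partial>circ) \<le> C * (\<integral>t. \<bar>\<phi> (cis t)\<bar> \<partial>circ)"
proof -
  interpret finite_measure circ by (rule finite_measure_circ)
  have cont: "continuous_on UNIV \<phi>" using \<phi> by (rule lipschitz_on_continuous_on)
  have B: "0 \<le> B" using order_trans[OF norm_ge_zero \<psi>(2)[of 0]] .
  have int\<phi>: "integrable circ (\<lambda>t. \<bar>\<phi> (cis t)\<bar>)"
  proof -
    have *: "continuous_on S (\<lambda>t. \<bar>\<phi> (cis t)\<bar>)" for S
      by (intro continuous_intros continuous_on_compose2[OF cont]) auto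
    show ?thesis by (rule integral_circ_eqI(1)[OF * integrable_integral[OF integrable_continuous_real[OF *]]])
  qed
  have main: "cmod (\<integral>t. \<psi> (cis t) * \<phi> (cis t) \<partial>circ) \<le> B * (2 * pi * ((1 + L\<^sup>2) * sqrt (1 - \<rho>\<^sup>2))) + C * (\<integral>t. \<bar>\<phi> (cis t)\<bar> \<partial>circ)"
    if \<rho>: "0 \<le> \<rho>" "\<rho> < 1" for \<rho>
  proof -
    define e where "e = 2 * pi * ((1 + L\<^sup>2) * sqrt (1 - \<rho>\<^sup>2))"
    define h where "h s = (\<integral>t. poisson_kernel (complex_of_real \<rho> * cis s) (cis t) * \<phi> (cis t) \<partial>circ)" for s
    have h: "\<bar>h s - 2 * pi * \<phi> (cis s)\<bar> \<le> e" for s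
      unfolding h_def e_def by (rule poisson_radial_error[OF \<phi> \<rho>]) simp
    note pairing = poisson_integral_pairing[OF \<psi> cont \<rho>, folded h_def]
    have int\<psi>\<phi>: "integrable circ (\<lambda>t. \<psi> (cis t) * complex_of_real (\<phi> (cis t)))"
    proof (rule Bochner_Integration.integrable_bound)
      show "integrable circ (\<lambda>t. B * \<bar>\<phi> (cis t)\<bar>)" using int\<phi> by simp
      show "AE t in circ. cmod (\<psi> (cis t) * complex_of_real (\<phi> (cis t))) \<le> norm (B * \<bar>\<phi> (cis t)\<bar>)"
        using \<psi>(2) B by (auto simp: norm_mult abs_mult intro!: mult_right_mono AE_I2)
      have "(\<lambda>t. \<phi> (cis t)) \<in> borel_measurable circ"
        by (intro borel_measurable_continuous_circ continuous_on_compose2[OF cont] continuous_intros) auto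
      then show "(\<lambda>t. \<psi> (cis t) * complex_of_real (\<phi> (cis t))) \<in> borel_measurable circ"
        using borel_measurable_integrable[OF \<psi>(1)] by measurable
    qed
    \<comment> \<open>The pairing at radius \<rho> is subtracted and added back: the first integral
      is the approximation error, the second is in its dual form.\<close>
    have "complex_of_real (2 * pi) * (\<integral>t. \<psi> (cis t) * \<phi> (cis t) \<partial>circ)
        = (\<integral>t. \<psi> (cis t) * (2 * pi * \<phi> (cis t)) - \<psi> (cis t) * h t \<partial>circ)
          + (\<integral>t. complex_of_real (2 * pi) * poisson \<psi> (\<rho> * cis t) * \<phi> (cis t) \<partial>circ)"
      using int\<psi>\<phi> pairing by (simp add: mult.left_commute[of "\<psi> _"])
    also have "cmod \<dots> \<le> 2 * pi * (B * e) + 2 * pi * (C * (\<integral>t. \<bar>\<phi> (cis t)\<bar> \<partial>circ))"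
    proof (rule norm_triangle_mono)
      have "cmod (\<integral>t. \<psi> (cis t) * (2 * pi * \<phi> (cis t)) - \<psi> (cis t) * h t \<partial>circ)
        \<le> (\<integral>t. cmod (\<psi> (cis t) * (2 * pi * \<phi> (cis t)) - \<psi> (cis t) * h t) \<partial>circ)"
        by (rule integral_norm_bound)
      also have "\<dots> \<le> (\<integral>t. B * e \<partial>circ)"
      proof (rule integral_mono')
        fix t
        have "\<psi> (cis t) * (2 * pi * \<phi> (cis t)) - \<psi> (cis t) * h t = \<psi> (cis t) * complex_of_real (2 * pi * \<phi> (cis t) - h t)"
          by (simp add: algebra_simps)
        then show "cmod (\<psi> (cis t) * (2 * pi * \<phi> (cis t)) - \<psi> (cis t) * h t) \<le> B * e"
          using h[of t] \<psi>(2)[of t] B by (simp only: norm_mult norm_of_real) (intro mult_mono; auto)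
        show "0 \<le> B * e" using B h[of 0] by (intro mult_nonneg_nonneg) linarith+
      qed simp
      also have "\<dots> = 2 * pi * (B * e)" using measure_circ by simp
      finally show "cmod (\<integral>t. \<psi> (cis t) * (2 * pi * \<phi> (cis t)) - \<psi> (cis t) * h t \<partial>circ) \<le> 2 * pi * (B * e)" .
      have "cmod (\<integral>t. complex_of_real (2 * pi) * poisson \<psi> (\<rho> * cis t) * \<phi> (cis t) \<partial>circ)
        \<le> (\<integral>t. cmod (complex_of_real (2 * pi) * poisson \<psi> (\<rho> * cis t) * \<phi> (cis t)) \<partial>circ)"
        by (rule integral_norm_bound)
      also have "\<dots> \<le> (\<integral>t. 2 * pi * C * \<bar>\<phi> (cis t)\<bar> \<partial>circ)"
      proof (rule integral_mono')
        show "integrable circ (\<lambda>t. 2 * pi * C * \<bar>\<phi> (cis t)\<bar>)" using int\<phi> by simp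
        fix t
        have *: "cmod (poisson \<psi> (\<rho> * cis t)) \<le> C" using \<rho> by (intro C) (simp add: norm_mult)
        then show "cmod (complex_of_real (2 * pi) * poisson \<psi> (\<rho> * cis t) * \<phi> (cis t)) \<le> 2 * pi * C * \<bar>\<phi> (cis t)\<bar>"
          by (auto simp: norm_mult intro!: mult_right_mono)
        show "0 \<le> 2 * pi * C * \<bar>\<phi> (cis t)\<bar>" using order_trans[OF norm_ge_zero *] by simp
      qed
      also have "\<dots> = 2 * pi * (C * (\<integral>t. \<bar>\<phi> (cis t)\<bar> \<partial>circ))" by simp
      finally show "cmod (\<integral>t. complex_of_real (2 * pi) * poisson \<psi> (\<rho> * cis t) * \<phi> (cis t) \<partial>circ)
        \<le> 2 * pi * (C * (\<integral>t. \<bar>\<phi> (cis t)\<bar> \<partial>circ))" .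
    qed
    finally have "2 * pi * cmod (\<integral>t. \<psi> (cis t) * \<phi> (cis t) \<partial>circ) \<le> 2 * pi * (B * e + C * (\<integral>t. \<bar>\<phi> (cis t)\<bar> \<partial>circ))"
      by (simp add: norm_mult distrib_left)
    then show ?thesis by (simp add: e_def)
  qed
  \<comment> \<open>Only the error term depends on \<rho>, and its factor
    \<open>sqrt (1 - \<rho>\<^sup>2)\<close> tends to 0.\<close>
  show ?thesis
  proof (rule tendsto_lowerbound)
    have "((\<lambda>\<rho>. B * (2 * pi * ((1 + L\<^sup>2) * sqrt (1 - \<rho>\<^sup>2))) + C * (\<integral>t. \<bar>\<phi> (cis t)\<bar> \<partial>circ)) \<longlongrightarrow>
       B * (2 * pi * ((1 + L\<^sup>2) * sqrt (1 - 1\<^sup>2))) + C * (\<integral>t. \<bar>\<phi> (cis t)\<bar> \<partial>circ)) (at_left 1)"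
      by (intro tendsto_intros)
    then show "((\<lambda>\<rho>. B * (2 * pi * ((1 + L\<^sup>2) * sqrt (1 - \<rho>\<^sup>2))) + C * (\<integral>t. \<bar>\<phi> (cis t)\<bar> \<partial>circ)) \<longlongrightarrow>
       C * (\<integral>t. \<bar>\<phi> (cis t)\<bar> \<partial>circ)) (at_left 1)" by simp
    show "\<forall>\<^sub>F \<rho> in at_left 1. cmod (\<integral>t. \<psi> (cis t) * \<phi> (cis t) \<partial>circ) \<le> B * (2 * pi * ((1 + L\<^sup>2) * sqrt (1 - \<rho>\<^sup>2))) + C * (\<integral>t. \<bar>\<phi> (cis t)\<bar> \<partial>circ)"
      using main by (auto intro!: eventually_at_leftI[of 0])
  qed simp
qed

section \<open>Almost everywhere bound on the boundary data\<close>

lemma AE_circ_neq: "AE t in circ. t \<noteq> c"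
proof -
  have "AE t in lebesgue. t \<noteq> c" by (rule AE_completion[OF AE_lborel_singleton])
  then show ?thesis by (simp add: AE_restrict_space_iff) (erule AE_mp, simp)
qed

text \<open>The angles differ by a multiple of 2 pi, and their difference lies strictly between -2
  pi and 2 pi because s is interior.\<close>

lemma cis_inj_interior:
  assumes "cis s = cis t" "0 < s" "s < 2 * pi" "0 \<le> t" "t \<le> 2 * pi"
  shows "s = t"
proof -
  have "cis (s - t) = 1" using assms(1) by (metis cis_divide cis_neq_zero divide_self)
  then have "cos (s - t) = 1" by (metis cis.simps(1) one_complex.simps(1))
  then obtain k :: int where k: "s - t = k * 2 * pi" by (auto simp: cos_one_2pi_int)
  then have "k * (2 * pi) < 1 * (2 * pi)" "(-1) * (2 * pi) < k * (2 * pi)" using assms by linarith+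
  then have "real_of_int k < 1" "-1 < real_of_int k"
    by (simp_all only: mult_less_cancel_right_pos pi_gt_zero zero_less_mult_iff zero_less_numeral simp_thms)
  then have "k = 0" by linarith
  then show ?thesis using k by simp
qed

text \<open>The indicator of K is almost everywhere the limit of Lipschitz cutoffs around its image
  on the circle, so dominated convergence carries the Lipschitz estimate over.\<close>

lemma norm_integral_closed_le:
  assumes \<psi>: "integrable circ (\<lambda>t. \<psi> (cis t))" "\<And>t. cmod (\<psi> (cis t)) \<le> B"
    and C: "\<And>z. cmod z < 1 \<Longrightarrow> cmod (poisson \<psi> z) \<le> C"
    and K: "closed K" "K \<subseteq> {0..2*pi}"
  shows "cmod (LINT t:K|circ. \<psi> (cis t)) \<le> C * measure circ K"
proof (cases "K = {}")
  \<comment> \<open>The empty set is treated apart since \<open>infdist\<close> to it is 0 by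
    convention, which would make the cutoffs constantly 1.\<close>
  case False
  interpret finite_measure circ by (rule finite_measure_circ)
  have B: "0 \<le> B" using order_trans[OF norm_ge_zero \<psi>(2)[of 0]] .
  \<comment> \<open>The cutoff is 1 on the image of K, has Lipschitz constant n, and for positive n
    vanishes at distance 1/n or more.\<close>
  define \<phi> where "\<phi> n \<zeta> = max 0 (1 - real n * infdist \<zeta> (cis ` K))" for n \<zeta>
  have "compact K" using K by (meson bounded_closed_interval bounded_subset compact_eq_bounded_closed)
  then have "compact (cis ` K)" by (intro compact_continuous_image continuous_intros)
  then have cl: "closed (cis ` K)" by (rule compact_imp_closed)
  have Ksets: "K \<in> sets circ" using K by (auto simp: sets_restrict_space_iff)
  have lip: "(real n)-lipschitz_on UNIV (\<phi> n)" for n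
  proof (rule lipschitz_onI)
    fix x y
    have "\<bar>\<phi> n x - \<phi> n y\<bar> \<le> \<bar>real n * infdist x (cis ` K) - real n * infdist y (cis ` K)\<bar>"
      unfolding \<phi>_def by linarith
    also have "\<dots> = real n * \<bar>infdist x (cis ` K) - infdist y (cis ` K)\<bar>"
      by (simp add: abs_mult flip: right_diff_distrib)
    also have "\<dots> \<le> real n * dist x y"
      by (intro mult_left_mono infdist_triangle_abs) auto
    finally show "dist (\<phi> n x) (\<phi> n y) \<le> real n * dist x y" by (simp add: dist_real_def)
  qed simp
  have meas: "(\<lambda>t. \<phi> n (cis t)) \<in> borel_measurable circ" for n
    by (intro borel_measurable_continuous_circ continuous_on_compose2[OF lipschitz_on_continuous_on[OF lip]] continuous_intros) auto
  have \<phi>01: "0 \<le> \<phi> n \<zeta>" "\<phi> n \<zeta> \<le> 1" for n \<zeta> by (auto simp: \<phi>_def infdist_nonneg)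
  \<comment> \<open>\<open>cis\<close> identifies 0 and 2 pi: if just one of them is in K, the
    cutoffs at the other do not tend to 0. Both end points are therefore discarded. At any other
    angle outside K, the image being closed gives a positive distance.\<close>
  have lim: "AE t in circ. (\<lambda>n. \<phi> n (cis t)) \<longlonglongrightarrow> indicator K t"
    using AE_circ_neq[of 0] AE_circ_neq[of "2*pi"] AE_space
  proof eventually_elim
    case (elim t)
    show ?case
    proof (cases "t \<in> K")
      case True
      then show ?thesis by (simp add: \<phi>_def)
    next
      case False
      then have "cis t \<notin> cis ` K"
        using K(2) elim cis_inj_interior[of t] by fastforce
      then have pos: "0 < infdist (cis t) (cis ` K)"
        using \<open>K \<noteq> {}\<close> cl by (simp add: infdist_pos_not_in_closed)
      then have "\<forall>\<^sub>F n in sequentially. 1 / infdist (cis t) (cis ` K) \<le> real n"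
        by (metis eventually_sequentiallyI nat_ceiling_le_eq)
      then have "\<forall>\<^sub>F n in sequentially. \<phi> n (cis t) = 0"
        by eventually_elim (use pos in \<open>simp add: \<phi>_def pos_divide_le_eq\<close>)
      then show ?thesis using False by (simp add: tendsto_eventually)
    qed
  qed
  have "(\<lambda>n. \<integral>t. \<psi> (cis t) * \<phi> n (cis t) \<partial>circ) \<longlonglongrightarrow> (\<integral>t. indicator K t *\<^sub>R \<psi> (cis t) \<partial>circ)"
  proof (rule integral_dominated_convergence[where w="\<lambda>_. B"])
    show "AE t in circ. (\<lambda>n. \<psi> (cis t) * complex_of_real (\<phi> n (cis t))) \<longlonglongrightarrow> indicator K t *\<^sub>R \<psi> (cis t)"
      using lim by eventually_elim (auto simp: scaleR_conv_of_real mult.commute intro!: tendsto_mult_left tendsto_of_real)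
    show "AE t in circ. cmod (\<psi> (cis t) * complex_of_real (\<phi> n (cis t))) \<le> B" for n
      using mult_mono[OF \<psi>(2) \<phi>01(2) B \<phi>01(1)] \<phi>01(1) by (simp add: norm_mult)
  qed (use meas borel_measurable_integrable[OF \<psi>(1)] Ksets in \<open>auto intro!: borel_measurable_scaleR borel_measurable_indicator\<close>)
  then have L: "(\<lambda>n. cmod (\<integral>t. \<psi> (cis t) * \<phi> n (cis t) \<partial>circ)) \<longlonglongrightarrow> cmod (LINT t:K|circ. \<psi> (cis t))"
    unfolding set_lebesgue_integral_def by (rule tendsto_norm)
  have "(\<lambda>n. \<integral>t. \<bar>\<phi> n (cis t)\<bar> \<partial>circ) \<longlonglongrightarrow> (\<integral>t. indicator K t \<partial>circ)"
  proof (rule integral_dominated_convergence[where w="\<lambda>_. 1"])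
    show "AE t in circ. (\<lambda>n. \<bar>\<phi> n (cis t)\<bar>) \<longlonglongrightarrow> indicator K t"
      using lim by eventually_elim (use \<phi>01 in simp)
    show "AE t in circ. norm \<bar>\<phi> n (cis t)\<bar> \<le> 1" for n
      using \<phi>01 by simp
  qed (use meas Ksets in auto)
  then have "(\<lambda>n. C * (\<integral>t. \<bar>\<phi> n (cis t)\<bar> \<partial>circ)) \<longlonglongrightarrow> C * measure circ K"
    using Ksets sets.sets_into_space[OF Ksets] by (intro tendsto_mult_left) (simp add: Int_absorb2)
  from LIMSEQ_le[OF L this] norm_integral_boundary_le[OF \<psi> C lip] show ?thesis by blast
qed (simp add: set_lebesgue_integral_def)

text \<open>Inner regularity extends the estimate from closed sets to all measurable sets. Every
  average of \<open>\<psi>\<close> then lies in the closed disc of radius C, and the averaging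
  theorem puts almost all values there.\<close>

lemma AE_boundary_le:
  assumes \<psi>: "integrable circ (\<lambda>t. \<psi> (cis t))" "\<And>t. cmod (\<psi> (cis t)) \<le> B"
    and C: "\<And>z. cmod z < 1 \<Longrightarrow> cmod (poisson \<psi> z) \<le> C"
  shows "AE t in circ. cmod (\<psi> (cis t)) \<le> C"
proof -
  interpret finite_measure circ by (rule finite_measure_circ)
  have B: "0 \<le> B" using order_trans[OF norm_ge_zero \<psi>(2)[of 0]] .
  have C0: "0 \<le> C" using order_trans[OF norm_ge_zero C[of 0]] by simp
  have le: "cmod (LINT t:A|circ. \<psi> (cis t)) \<le> C * measure circ A" if A: "A \<in> sets circ" for A
  proof (rule field_le_epsilon)
    fix e :: real assume "0 < e"
    \<comment> \<open>The exceptional set contributes at most B times its measure; dividing by B + 1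
      keeps the denominator positive when B = 0.\<close>
    then have "0 < e / (B + 1)" using B by simp
    moreover have "A \<in> sets lebesgue" "A \<subseteq> {0..2*pi}" using A by (auto simp: sets_restrict_space_iff)
    ultimately obtain T where T: "closed T" "T \<subseteq> A" "emeasure lebesgue (A - T) < ennreal (e / (B + 1))"
      using sets_lebesgue_inner_closed by metis
    have T2: "T \<in> sets circ" "T \<subseteq> {0..2*pi}" using T \<open>A \<subseteq> _\<close> by (auto simp: sets_restrict_space_iff)
    have "emeasure circ (A - T) < ennreal (e / (B + 1))"
      using T(3) \<open>A \<subseteq> _\<close> by (subst emeasure_restrict_space) auto
    then have "measure circ (A - T) < e / (B + 1)"
      using \<open>0 < e / (B + 1)\<close> by (simp add: emeasure_eq_measure ennreal_less_iff)
    then have AT: "(B + 1) * measure circ (A - T) \<le> e" using B by (simp add: field_simps)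
    have si: "set_integrable circ X (\<lambda>t. \<psi> (cis t))" if "X \<in> sets circ" for X
      using \<psi>(1) that unfolding set_integrable_def by (rule integrable_mult_indicator[rotated])
    have "A = T \<union> (A - T)" using T by auto
    then have "(LINT t:A|circ. \<psi> (cis t)) = (LINT t:T|circ. \<psi> (cis t)) + (LINT t:A-T|circ. \<psi> (cis t))"
      using set_integral_Un[of T "A - T" circ "\<lambda>t. \<psi> (cis t)"] si T2 A by auto
    also have "cmod \<dots> \<le> C * measure circ T + B * measure circ (A - T)"
    proof (rule norm_triangle_mono)
      show "cmod (LINT t:T|circ. \<psi> (cis t)) \<le> C * measure circ T"
        by (rule norm_integral_closed_le[OF \<psi> C T(1) T2(2)])
      have "cmod (LINT t:A-T|circ. \<psi> (cis t)) \<le> (\<integral>t. norm (indicator (A - T) t *\<^sub>R \<psi> (cis t)) \<partial>circ)"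
        unfolding set_lebesgue_integral_def by (rule integral_norm_bound)
      also have "\<dots> \<le> (\<integral>t. B * indicator (A - T) t \<partial>circ)"
      proof (rule integral_mono')
        show "integrable circ (\<lambda>t. B * indicator (A - T) t)"
          using A T2 by (intro integrable_mult_right integrable_real_indicator) (auto simp: emeasure_eq_measure)
        show "norm (indicator (A - T) t *\<^sub>R \<psi> (cis t)) \<le> B * indicator (A - T) t" for t
          using \<psi>(2) by (cases "t \<in> A - T") auto
        show "0 \<le> B * indicator (A - T) t" for t using B by simp
      qed
      also have "\<dots> = B * measure circ (A - T)"
        using sets.sets_into_space[OF A] by (simp add: Int_absorb2 Diff_subset_conv le_supI2)
      finally show "cmod (LINT t:A-T|circ. \<psi> (cis t)) \<le> B * measure circ (A - T)" .
    qed
    also have "\<dots> \<le> C * measure circ A + e"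
    proof (rule add_mono)
      show "C * measure circ T \<le> C * measure circ A"
        using T A C0 by (intro mult_left_mono finite_measure_mono)
      show "B * measure circ (A - T) \<le> e" using AT measure_nonneg[of circ "A - T"] unfolding distrib_right by linarith
    qed
    finally show "cmod (LINT t:A|circ. \<psi> (cis t)) \<le> C * measure circ A + e" .
  qed
  have "AE t in circ. \<psi> (cis t) \<in> cball 0 C"
  proof (rule averaging_theorem[OF \<psi>(1) closed_cball])
    fix A assume A: "A \<in> sets circ" "0 < measure circ A"
    then show "(1 / measure circ A) *\<^sub>R (LINT t:A|circ. \<psi> (cis t)) \<in> cball 0 C"
      using le[OF A(1)] by (simp add: field_simps)
  qed
  then show ?thesis by simp
qed

section \<open>Estimate of the Poisson part\<close>

text \<open>The constant is the normalisation 1/(2 pi) times the total deviation 8 arctan |z|. A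
  bound on \<open>\<psi>\<close> almost everywhere is enough under the integral.\<close>

lemma poisson_schwarz:
  assumes \<psi>: "integrable circ (\<lambda>t. \<psi> (cis t))" "AE t in circ. cmod (\<psi> (cis t)) \<le> C" and z: "cmod z < 1"
  defines "q \<equiv> (1 - (cmod z)\<^sup>2) / (1 + (cmod z)\<^sup>2)"
  shows "cmod (poisson \<psi> z - complex_of_real (1 / (2 * pi) * q) * (\<integral>t. \<psi> (cis t) \<partial>circ))
    \<le> 4 * C / pi * arctan (cmod z)"
proof -
  define P where "P t = poisson_kernel z (cis t)" for t
  note dev = integral_poisson_kernel_deviation[OF z, folded q_def P_def]
  have contP: "continuous_on UNIV P" unfolding P_def[abs_def] by (rule continuous_on_poisson_kernel_cis[OF z])
  have [measurable]: "(\<lambda>t. \<psi> (cis t)) \<in> borel_measurable circ" using \<psi>(1) by auto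
  have [measurable]: "P \<in> borel_measurable circ" by (rule borel_measurable_continuous_circ[OF contP])
  have dom: "AE t in circ. cmod (complex_of_real (P t - q) * \<psi> (cis t)) \<le> C * \<bar>P t - q\<bar>"
    using \<psi>(2) by eventually_elim (simp add: norm_mult mult.commute[of C] mult_left_mono del: of_real_diff)
  have int: "integrable circ (\<lambda>t. complex_of_real (P t - q) * \<psi> (cis t))"
  proof (rule Bochner_Integration.integrable_bound)
    show "integrable circ (\<lambda>t. C * \<bar>P t - q\<bar>)" using dev by simp
    show "AE t in circ. cmod (complex_of_real (P t - q) * \<psi> (cis t)) \<le> norm (C * \<bar>P t - q\<bar>)"
      using dom by eventually_elim (metis order_trans abs_ge_self real_norm_def)
  qed measurable
  \<comment> \<open>Adding \<open>q * \<psi>\<close> back yields integrability of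
    \<open>P * \<psi>\<close>, so that the integral of the difference may be split.\<close>
  then have "integrable circ (\<lambda>t. complex_of_real (P t - q) * \<psi> (cis t) + complex_of_real q * \<psi> (cis t))"
    using \<psi>(1) by (intro Bochner_Integration.integrable_add) auto
  then have intP: "integrable circ (\<lambda>t. complex_of_real (P t) * \<psi> (cis t))"
    by (simp add: distrib_right[symmetric])
  have "poisson \<psi> z - complex_of_real (1 / (2 * pi) * q) * (\<integral>t. \<psi> (cis t) \<partial>circ)
     = complex_of_real (1 / (2 * pi)) * ((\<integral>t. complex_of_real (P t) * \<psi> (cis t) \<partial>circ) - complex_of_real q * (\<integral>t. \<psi> (cis t) \<partial>circ))"
    by (simp add: poisson_def P_def integral_circ_eq right_diff_distrib)
  also have "(\<integral>t. complex_of_real (P t) * \<psi> (cis t) \<partial>circ) - complex_of_real q * (\<integral>t. \<psi> (cis t) \<partial>circ)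
      = (\<integral>t. complex_of_real (P t - q) * \<psi> (cis t) \<partial>circ)"
    using intP \<psi>(1) by (simp add: left_diff_distrib)
  also have "cmod (complex_of_real (1 / (2 * pi)) * \<dots>) = 1 / (2 * pi) * cmod (\<integral>t. complex_of_real (P t - q) * \<psi> (cis t) \<partial>circ)"
    by (simp only: norm_mult norm_of_real) simp
  also have "\<dots> \<le> 1 / (2 * pi) * (C * (8 * arctan (cmod z)))"
  proof (rule mult_left_mono)
    have "cmod (\<integral>t. complex_of_real (P t - q) * \<psi> (cis t) \<partial>circ) \<le> (\<integral>t. cmod (complex_of_real (P t - q) * \<psi> (cis t)) \<partial>circ)"
      by (rule integral_norm_bound)
    also have "\<dots> \<le> (\<integral>t. C * \<bar>P t - q\<bar> \<partial>circ)"
      using int dev dom by (intro integral_mono_AE) auto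
    also have "\<dots> = C * (8 * arctan (cmod z))" using dev by simp
    finally show "cmod (\<integral>t. complex_of_real (P t - q) * \<psi> (cis t) \<partial>circ) \<le> C * (8 * arctan (cmod z))" .
  qed simp
  also have "\<dots> = 4 * C / pi * arctan (cmod z)" by simp
  finally show ?thesis .
qed

section \<open>The Green potential\<close>

text \<open>Carries the plane \<open>real ^ 2\<close>, on which orthogonal maps act, over to the
  complex numbers.\<close>

definition complex_of_vec2 :: "real ^ 2 \<Rightarrow> complex" where
  "complex_of_vec2 v = Complex (v $ 1) (v $ 2)"

lemma complex_of_vec2_borel [measurable]: "complex_of_vec2 \<in> borel_measurable borel"
  unfolding complex_of_vec2_def[abs_def] Complex_eq by measurable

lemma complex_of_vec2_preimage_box:
  "complex_of_vec2 -` box l u = box (vector [Re l, Im l]) (vector [Re u, Im u])"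
  by (auto simp: complex_of_vec2_def box_Complex_eq mem_box_cart forall_2 in_box_complex_iff)

text \<open>Lebesgue measure is determined by its values on boxes, and the preimage of a box is a
  box with the same side lengths.\<close>

lemma lborel_complex_of_vec2: "distr lborel borel complex_of_vec2 = lborel"
proof (rule lborel_eqI[symmetric])
  fix l u :: complex assume "\<And>b. b \<in> Basis \<Longrightarrow> l \<bullet> b \<le> u \<bullet> b"
  then have "l \<bullet> 1 \<le> u \<bullet> 1" "l \<bullet> \<i> \<le> u \<bullet> \<i>" unfolding Basis_complex_def by blast+
  then show "emeasure (distr lborel borel complex_of_vec2) (box l u) = (\<Prod>b\<in>Basis. (u - l) \<bullet> b)"
    by (simp add: emeasure_distr complex_of_vec2_preimage_box emeasure_lborel_box_eq Basis_complex_def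
        Basis_vec_def UNIV_2 inner_axis axis_eq_axis)
qed simp

text \<open>The preimage of a box is its image under the inverse map, which is again orthogonal and
  so preserves measure.\<close>

lemma lborel_orthogonal_transformation:
  fixes f :: "real ^ 'n::{finite,wellorder} \<Rightarrow> real ^ 'n::_"
  assumes f: "orthogonal_transformation f"
  shows "distr lborel borel f = lborel"
proof (rule lborel_eqI[symmetric])
  have lin: "linear f" by (rule orthogonal_transformation_linear[OF f])
  have bij: "bij f" by (rule orthogonal_transformation_bij[OF f])
  have meas: "f \<in> borel_measurable borel"
    by (intro borel_measurable_continuous_onI linear_continuous_on) (simp add: lin linear_conv_bounded_linear[symmetric])
  fix l u :: "real ^ 'n::_" assume lu: "\<And>b. b \<in> Basis \<Longrightarrow> l \<bullet> b \<le> u \<bullet> b"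
  have pre: "f -` box l u = inv f ` box l u" using bij by (simp add: bij_vimage_eq_inv_image)
  have orth: "orthogonal_transformation (inv f)" using f by (rule orthogonal_transformation_inv)
  have lmeas: "f -` box l u \<in> lmeasurable" unfolding pre by (rule measurable_orthogonal_image[OF orth]) simp
  have bor: "f -` box l u \<in> sets lborel" using measurable_sets[OF meas, of "box l u"] by simp
  then have "emeasure lborel (f -` box l u) = emeasure lebesgue (f -` box l u)" by simp
  also have "\<dots> = ennreal (measure lebesgue (f -` box l u))" by (rule emeasure_eq_measure2[OF lmeas])
  also have "measure lebesgue (f -` box l u) = measure lebesgue (box l u)"
    unfolding pre by (rule measure_orthogonal_image[OF orth]) simp
  also have "ennreal \<dots> = (\<Prod>b\<in>Basis. (u - l) \<bullet> b)"
    using lu by (simp add: measure_def emeasure_lborel_box_eq)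
  finally show "emeasure (distr lborel borel f) (box l u) = (\<Prod>b\<in>Basis. (u - l) \<bullet> b)"
    using meas by (simp add: emeasure_distr)
qed simp

text \<open>Under the identification with \<open>real ^ 2\<close>, multiplication by
  \<open>cis t\<close> becomes the rotation matrix R, which is orthogonal.\<close>

lemma lborel_rotate: "distr lborel borel (\<lambda>w. cis t * w) = (lborel :: complex measure)"
proof -
  define R :: "real ^ 2 \<Rightarrow> real ^ 2" where
    "R v = vector [cos t * v $ 1 - sin t * v $ 2, sin t * v $ 1 + cos t * v $ 2]" for v
  have R: "orthogonal_transformation R"
    unfolding orthogonal_transformation
  proof
    show "linear R"
      by (rule linearI) (auto simp: R_def vec_eq_iff forall_2 algebra_simps)
    have *: "(c * x - s * y)\<^sup>2 + (s * x + c * y)\<^sup>2 = (s\<^sup>2 + c\<^sup>2) * (x\<^sup>2 + y\<^sup>2)" for c s x y :: real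
      by algebra
    show "\<forall>v. norm (R v) = norm v"
      by (simp add: R_def norm_vec_def L2_set_def sum_2 *)
  qed
  have RT: "cis t * complex_of_vec2 v = complex_of_vec2 (R v)" for v
    by (simp add: complex_of_vec2_def R_def complex_eq_iff)
  have [measurable]: "R \<in> borel_measurable borel"
    by (intro borel_measurable_continuous_onI linear_continuous_on)
       (simp add: R orthogonal_transformation_linear linear_conv_bounded_linear[symmetric])
  have "distr lborel borel (\<lambda>w. cis t * w) = distr (distr lborel borel complex_of_vec2) borel (\<lambda>w. cis t * w)"
    by (simp add: lborel_complex_of_vec2)
  also have "\<dots> = distr lborel borel (\<lambda>v. complex_of_vec2 (R v))"
    by (subst distr_distr) (auto simp: o_def RT)
  also have "\<dots> = distr (distr lborel borel R) borel complex_of_vec2"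
    by (subst distr_distr) (auto simp: o_def)
  finally show ?thesis by (simp add: lborel_orthogonal_transformation[OF R] lborel_complex_of_vec2)
qed

lemma nn_integral_rotate:
  assumes [measurable]: "f \<in> borel_measurable borel"
  shows "(\<integral>\<^sup>+w. f (cis t * w) \<partial>lborel) = (\<integral>\<^sup>+w. f w \<partial>lborel)"
  by (subst (2) lborel_rotate[of t, symmetric]) (simp add: nn_integral_distr)

section \<open>Circle means of the Green kernel\<close>

text \<open>Mean value property: \<open>Ln (1 - a * u)\<close> is holomorphic on the closed unit
  disc, as its argument has positive real part, and it vanishes at u = 0. Cauchy's formula at 0
  gives mean zero.\<close>

lemma has_integral_ln_one_minus_circle:
  assumes a: "cmod a < 1"
  shows "((\<lambda>t. ln (cmod (1 - a * cis t))) has_integral 0) {0..2*pi}"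
proof -
  have pos: "0 < Re (1 - a * u)" if "cmod u \<le> 1" for u
  proof -
    have "Re (a * u) \<le> cmod a * cmod u" using complex_Re_le_cmod[of "a * u"] by (simp add: norm_mult)
    also have "\<dots> \<le> cmod a" using that by (simp add: mult_left_le)
    finally show ?thesis using a by simp
  qed
  then have nonpos: "1 - a * u \<notin> \<real>\<^sub>\<le>\<^sub>0" if "cmod u \<le> 1" for u
    using that by (metis complex_nonpos_Reals_iff linorder_not_less)
  have "(\<lambda>u. Ln (1 - a * u)) holomorphic_on cball 0 1"
    using nonpos by (intro holomorphic_intros) auto
  from Cauchy_integral_circlepath_simple[OF this, of 0]
  have "((\<lambda>u. Ln (1 - a * u) / u) has_contour_integral 0) (part_circlepath 0 1 0 (2*pi))"
    by (simp add: circlepath_def)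
  \<comment> \<open>The factor \<open>\<i> * cis t\<close> is the derivative of the path. It cancels
    the division by \<open>cis t\<close>, and the remaining \<i> turns the imaginary part of the
    integrand into the real part of the logarithm.\<close>
  then have "((\<lambda>t. Ln (1 - a * cis t) / cis t * \<i> * cis t) has_integral 0) {0..2*pi}"
    by (subst (asm) has_contour_integral_part_circlepath_iff) (auto)
  then have "((\<lambda>t. \<i> * Ln (1 - a * cis t)) has_integral 0) {0..2*pi}"
    by (rule has_integral_eq[rotated]) simp
  from has_integral_linear[OF this bounded_linear_Im]
  have "((\<lambda>t. Re (Ln (1 - a * cis t))) has_integral 0) {0..2*pi}"
    by (simp add: o_def)
  then show ?thesis
  proof (rule has_integral_eq[rotated])
    fix t
    have "1 - a * cis t \<noteq> 0" using pos[of "cis t"] by (metis norm_cis order_refl order_less_irrefl zero_complex.simps(1))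
    then show "Re (Ln (1 - a * cis t)) = ln (cmod (1 - a * cis t))" by simp
  qed
qed

lemma cmod_one_minus_mult_cis_uminus: "cmod (1 - a * cis (- t)) = cmod (1 - cnj a * cis t)"
proof -
  have "1 - cnj a * cis t = cnj (1 - a * cis (- t))" by (simp add: cis_cnj)
  then show ?thesis by (simp only: complex_mod_cnj)
qed

text \<open>Once the larger modulus is factored out of \<open>z - cis t * w\<close>, both numerator
  and denominator have the form |1 - c cis t| with |c| < 1 and contribute mean zero to the
  logarithm; only the factored constant survives.\<close>

lemma has_integral_green_kernel_circle:
  assumes z: "cmod z < 1" and w: "cmod w < 1" and ne: "cmod w \<noteq> cmod z"
  shows "((\<lambda>t. green_kernel z (cis t * w)) has_integral - (2 * pi * ln (max (cmod z) (cmod w)))) {0..2*pi}"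
proof -
  \<comment> \<open>The quotient of the smaller by the larger of z and w, conjugated when w is the
    larger; unequal moduli keep it strictly inside the disk.\<close>
  obtain b where b: "cmod b < 1" and
    eq: "\<And>t. cmod (z - cis t * w) = max (cmod z) (cmod w) * cmod (1 - b * cis t)"
  proof (cases "cmod w < cmod z")
    case True
    then have nz: "z \<noteq> 0" by auto
    then have "z - cis t * w = z * (1 - w / z * cis t)" for t by (simp add: field_simps)
    with True nz show ?thesis
      by (intro that[of "w / z"]) (simp add: norm_divide, metis norm_mult max.absorb1 less_imp_le)
  next
    case False
    then have lt: "cmod z < cmod w" and nz: "w \<noteq> 0" using ne by auto
    have "cmod (z - cis t * w) = max (cmod z) (cmod w) * cmod (1 - cnj (z / w) * cis t)" for t
    proof -
      have "z - cis t * w = - (cis t * w) * (1 - z / w * cis (- t))"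
        using nz by (simp add: field_simps cis_mult)
      then have "cmod (z - cis t * w) = cmod w * cmod (1 - z / w * cis (- t))"
        by (simp add: norm_mult)
      then show ?thesis using lt by (simp only: cmod_one_minus_mult_cis_uminus)
    qed
    then show ?thesis using lt nz by (intro that[of "cnj (z / w)"]) (auto simp: norm_divide)
  qed
  define m where "m = max (cmod z) (cmod w)"
  have m: "0 < m" using ne by (auto simp: m_def max_def)
  define a where "a = cnj (z * cnj w)"
  have a: "cmod a < 1"
    using z w mult_strict_mono[of "cmod z" 1 "cmod w" 1] by (simp add: a_def norm_mult)
  have nz: "1 - c * cis t \<noteq> 0" if "cmod c < 1" for c t
    using that by (metis norm_mult norm_cis mult.right_neutral norm_one order_less_irrefl eq_iff_diff_eq_0)
  have "green_kernel z (cis t * w) = ln (cmod (1 - a * cis t)) - ln (cmod (1 - b * cis t)) - ln m" for t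
  proof -
    have "cmod (1 - z * cnj (cis t * w)) = cmod (1 - (z * cnj w) * cis (- t))" by (simp add: cis_cnj mult_ac)
    then have "cmod (1 - z * cnj (cis t * w)) = cmod (1 - a * cis t)"
      by (simp only: cmod_one_minus_mult_cis_uminus a_def)
    then have "green_kernel z (cis t * w) = ln (cmod (1 - a * cis t) / (m * cmod (1 - b * cis t)))"
      unfolding green_kernel_def norm_divide eq m_def by simp
    also have "\<dots> = ln (cmod (1 - a * cis t)) - (ln m + ln (cmod (1 - b * cis t)))"
      using m nz[OF a] nz[OF b] by (subst ln_div; simp add: ln_mult)
    finally show ?thesis by simp
  qed
  moreover have "((\<lambda>t. ln (cmod (1 - a * cis t)) - ln (cmod (1 - b * cis t)) - ln m) has_integral
      0 - 0 - (2 * pi - 0) *\<^sub>R ln m) {0..2*pi}"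
    using has_integral_const_real[of "ln m" 0 "2*pi"]
    by (intro has_integral_diff has_integral_ln_one_minus_circle a b) simp
  ultimately show ?thesis by (simp add: m_def)
qed

text \<open>The identity |1 - z cnj w|^2 - |z - w|^2 = (1 - |z|^2) (1 - |w|^2) shows that the
  quotient has modulus at least 1 off the diagonal.\<close>

lemma green_kernel_nonneg:
  assumes z: "cmod z < 1" and w: "cmod w < 1"
  shows "0 \<le> green_kernel z w"
\<comment> \<open>On the diagonal the denominator is zero, and the default values of division and
  \<open>ln\<close> settle the claim.\<close>
proof (cases "z = w")
  case False
  have "(cmod (1 - z * cnj w))\<^sup>2 - (cmod (z - w))\<^sup>2 = (1 - (cmod z)\<^sup>2) * (1 - (cmod w)\<^sup>2)"
    unfolding cmod_power2 by (simp add: power2_eq_square algebra_simps)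
  moreover have "0 \<le> (1 - (cmod z)\<^sup>2) * (1 - (cmod w)\<^sup>2)"
    using z w by (intro mult_nonneg_nonneg) (auto simp: abs_square_le_1)
  ultimately have "(cmod (z - w))\<^sup>2 \<le> (cmod (1 - z * cnj w))\<^sup>2" by linarith
  then have "cmod (z - w) \<le> cmod (1 - z * cnj w)" by (rule power2_le_imp_le) simp
  then show ?thesis using False by (simp add: green_kernel_def norm_divide)
qed (simp add: green_kernel_def)

lemma green_kernel_borel [measurable]: "green_kernel z \<in> borel_measurable borel"
proof -
  have [measurable]: "cnj \<in> borel_measurable borel"
    by (intro borel_measurable_continuous_onI continuous_intros)
  show ?thesis unfolding green_kernel_def[abs_def] by measurable
qed

lemma nn_integral_green_kernel_circle:
  assumes z: "cmod z < 1" and w: "cmod w < 1" and ne: "cmod w \<noteq> cmod z"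
  shows "(\<integral>\<^sup>+t. ennreal (green_kernel z (cis t * w)) * indicator {0..2*pi} t \<partial>lborel)
    = ennreal (2 * pi) * ennreal (- ln (max (cmod z) (cmod w)))"
proof -
  have m: "0 < max (cmod z) (cmod w)" using ne by (auto simp: max_def)
  have "(\<integral>\<^sup>+t. ennreal (green_kernel z (cis t * w)) * indicator {0..2*pi} t \<partial>lborel)
     = ennreal (- (2 * pi * ln (max (cmod z) (cmod w))))"
    using z w by (intro nn_integral_has_integral_lebesgue' has_integral_green_kernel_circle ne green_kernel_nonneg)
       (auto simp: norm_mult)
  also have "- (2 * pi * ln (max (cmod z) (cmod w))) = 2 * pi * (- ln (max (cmod z) (cmod w)))" by simp
  finally show ?thesis using m z w by (subst (asm) ennreal_mult) auto
qed

section \<open>Area integral of the Green kernel\<close>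

lemma ball_borel [measurable]: "ball (a::complex) r \<in> sets borel" by simp

text \<open>The radial integral \<open>- ln (max |z| |w|)\<close> is written as a superposition of indicators of discs,
  so that Tonelli reduces the area integral to the areas of discs.\<close>

lemma nn_integral_neg_ln_max:
  assumes z: "cmod z < 1"
  shows "(\<integral>\<^sup>+w. ennreal (- ln (max (cmod z) (cmod w))) * indicator (ball 0 1) w \<partial>lborel)
    = ennreal (pi / 2 * (1 - (cmod z)\<^sup>2))"
proof -
  \<comment> \<open>With m = max |z| |w|, minus ln m is the integral of 1/s over [m, 1], and s is at
    least m exactly when it is at least both moduli. Excluding w = 0 ensures m > 0 even for z =
    0.\<close>
  have layer: "ennreal (- ln (max (cmod z) (cmod w))) * indicator (ball 0 1) w
     = (\<integral>\<^sup>+s. ennreal (1 / s) * indicator {cmod z..1} s * (if cmod w \<le> s then 1 else 0) * indicator (ball 0 1) w \<partial>lborel)"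
    if "w \<noteq> 0" for w
  proof (cases "w \<in> ball 0 1")
    case True
    define m where "m = max (cmod z) (cmod w)"
    have m: "0 < m" "m \<le> 1" using True that z by (auto simp: m_def less_max_iff_disj)
    have "(\<integral>\<^sup>+s. ennreal (1 / s) * indicator {m..1} s \<partial>lborel) = ln 1 - ln m"
      by (rule nn_integral_FTC_Icc) (use m in \<open>auto intro!: derivative_eq_intros\<close>)
    moreover have "ennreal (1 / s) * indicator {cmod z..1} s * (if cmod w \<le> s then 1 else 0) * indicator (ball 0 1) w = ennreal (1 / s) * indicator {m..1} s" for s
      using True by (auto simp: indicator_def m_def)
    ultimately show ?thesis using True by (simp add: m_def)
  qed simp
  have "(\<integral>\<^sup>+w. ennreal (- ln (max (cmod z) (cmod w))) * indicator (ball 0 1) w \<partial>lborel)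
     = (\<integral>\<^sup>+w. (\<integral>\<^sup>+s. ennreal (1 / s) * indicator {cmod z..1} s * (if cmod w \<le> s then 1 else 0) * indicator (ball 0 1) w \<partial>lborel) \<partial>lborel)"
    using AE_lborel_singleton[of 0] layer by (intro nn_integral_cong_AE) (auto elim!: eventually_mono)
  also have "\<dots> = (\<integral>\<^sup>+s. (\<integral>\<^sup>+w. ennreal (1 / s) * indicator {cmod z..1} s * (if cmod w \<le> s then 1 else 0) * indicator (ball 0 1) w \<partial>lborel) \<partial>lborel)"
    by (rule lborel_pair.Fubini') measurable
  also have "\<dots> = (\<integral>\<^sup>+s. ennreal (pi * s) * indicator {cmod z..1} s \<partial>lborel)"
  proof (rule nn_integral_cong_AE)
    show "AE s in lborel. (\<integral>\<^sup>+w. ennreal (1 / s) * indicator {cmod z..1} s * (if cmod w \<le> s then 1 else 0) * indicator (ball 0 1) w \<partial>lborel)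
       = ennreal (pi * s) * indicator {cmod z..1} s"
      \<comment> \<open>For s < 1 the closed disc of radius s lies in the open unit disk; s = 1 is a
        null set.\<close>
      using AE_lborel_singleton[of 1]
    proof eventually_elim
      case (elim s)
      show ?case
      proof (cases "s \<in> {cmod z..1}")
        case True
        then have s: "0 \<le> s" "s < 1" using elim order_trans[OF norm_ge_zero, of z s] by auto
        have "(\<integral>\<^sup>+w. ennreal (1 / s) * indicator {cmod z..1} s * (if cmod w \<le> s then 1 else 0) * indicator (ball 0 1) w \<partial>lborel)
          = (\<integral>\<^sup>+w. ennreal (1 / s) * indicator (cball (0::complex) s) w \<partial>lborel)"
          using True s by (intro nn_integral_cong) (auto simp: indicator_def)
        also have "\<dots> = ennreal (1 / s) * ennreal (pi * s\<^sup>2)"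
          using s by (subst nn_integral_cmult_indicator) (simp_all add: emeasure_cball unit_ball_vol_2)
        also have "\<dots> = ennreal (pi * s)"
          using s by (simp flip: ennreal_mult) (simp add: power2_eq_square)
        finally show ?thesis using True by simp
      qed simp
    qed
  qed
  also have "\<dots> = ennreal (pi / 2 * 1\<^sup>2 - pi / 2 * (cmod z)\<^sup>2)"
  proof (rule nn_integral_FTC_Icc)
    show "0 \<le> pi * s" if "s \<in> {cmod z..1}" for s
      using that order_trans[OF norm_ge_zero, of z s] by simp
  qed (use z in \<open>auto intro!: derivative_eq_intros\<close>)
  also have "pi / 2 * 1\<^sup>2 - pi / 2 * (cmod z)\<^sup>2 = pi / 2 * (1 - (cmod z)\<^sup>2)"
    unfolding right_diff_distrib by simp
  finally show ?thesis .
qed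

text \<open>Averaging over all rotations leaves the area integral unchanged. Tonelli then puts the
  angular integral inside, where the circle mean is known, and the factor 2 pi is cancelled.\<close>

lemma nn_integral_green_kernel:
  assumes z: "cmod z < 1"
  shows "(\<integral>\<^sup>+w. ennreal (green_kernel z w) * indicator (ball 0 1) w \<partial>lborel)
    = ennreal (pi / 2 * (1 - (cmod z)\<^sup>2))" (is "?J = _")
proof -
  let ?f = "\<lambda>w. ennreal (green_kernel z w) * indicator (ball 0 1) w"
  have cont: "continuous_on UNIV (\<lambda>p. cis (snd p) * fst p)"
    by (intro continuous_intros)
  have cm [measurable]: "(\<lambda>p. cis (snd p) * fst p) \<in> borel \<Otimes>\<^sub>M borel \<rightarrow>\<^sub>M borel"
    unfolding borel_prod by (rule borel_measurable_continuous_onI[OF cont])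
  have f [measurable]: "?f \<in> borel_measurable borel" by measurable
  have fm: "(\<lambda>p. ?f (cis (snd p) * fst p) * indicator {0..2*pi} (snd p)) \<in> borel_measurable (borel \<Otimes>\<^sub>M borel)"
    using measurable_compose[OF cm f] by measurable
  have "ennreal (2 * pi) * ?J = (\<integral>\<^sup>+t. ?J * indicator {0..2*pi} t \<partial>lborel)"
    by (subst nn_integral_cmult_indicator) (simp_all add: mult.commute)
  also have "\<dots> = (\<integral>\<^sup>+t. (\<integral>\<^sup>+w. ?f (cis t * w) * indicator {0..2*pi} t \<partial>lborel) \<partial>lborel)"
  proof (rule nn_integral_cong)
    fix t :: real
    have "(\<lambda>w. ?f (cis t * w)) \<in> borel_measurable lborel"
      by (rule measurable_compose[OF _ f]) measurable
    then show "?J * indicator {0..2*pi} t = (\<integral>\<^sup>+w. ?f (cis t * w) * indicator {0..2*pi} t \<partial>lborel)"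
      by (subst nn_integral_multc) (simp_all only: nn_integral_rotate[OF f])
  qed
  also have "\<dots> = (\<integral>\<^sup>+w. (\<integral>\<^sup>+t. ?f (cis t * w) * indicator {0..2*pi} t \<partial>lborel) \<partial>lborel)"
    by (rule lborel_pair.Fubini') (use fm in \<open>simp add: case_prod_beta\<close>)
  also have "\<dots> = (\<integral>\<^sup>+w. ennreal (2 * pi) * (ennreal (- ln (max (cmod z) (cmod w))) * indicator (ball 0 1) w) \<partial>lborel)"
  proof (rule nn_integral_cong_AE)
    \<comment> \<open>The circle mean was computed only for |w| different from |z|; the exceptional
      circle has area zero.\<close>
    have "sphere (0::complex) (cmod z) \<in> null_sets lborel"
      using negligible_sphere[of "0::complex" "cmod z"]
      by (simp add: negligible_iff_null_sets null_sets_completion_iff)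
    from AE_not_in[OF this]
    show "AE w in lborel. (\<integral>\<^sup>+t. ?f (cis t * w) * indicator {0..2*pi} t \<partial>lborel)
      = ennreal (2 * pi) * (ennreal (- ln (max (cmod z) (cmod w))) * indicator (ball 0 1) w)"
    proof eventually_elim
      case (elim w)
      show ?case
      proof (cases "cmod w < 1")
        case True
        then have "?f (cis t * w) = ennreal (green_kernel z (cis t * w))" for t by (simp add: norm_mult)
        then show ?thesis using nn_integral_green_kernel_circle[OF z True] elim True by simp
      next
        case False
        then have "indicator (ball 0 1) (cis t * w) = (0::ennreal)" "indicator (ball 0 1) w = (0::ennreal)" for t
          by (simp_all add: norm_mult)
        then show ?thesis by (simp only: mult_zero_right mult_zero_left nn_integral_const)
      qed
    qed
  qed
  also have "\<dots> = ennreal (2 * pi) * ennreal (pi / 2 * (1 - (cmod z)\<^sup>2))"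
    by (subst nn_integral_cmult) (simp_all add: nn_integral_neg_ln_max[OF z])
  finally show ?thesis
    by (subst (asm) ennreal_mult_cancel_left) auto
qed

text \<open>Since the kernel is nonnegative on the disk, its finite extended integral gives both
  integrability and the value.\<close>

lemma integral_green_kernel:
  assumes z: "cmod z < 1"
  shows "set_integrable lebesgue (ball 0 1) (green_kernel z)"
    and "(LINT w:ball 0 1|lebesgue. green_kernel z w) = pi / 2 * (1 - (cmod z)\<^sup>2)"
proof -
  let ?f = "\<lambda>w. indicator (ball 0 1) w *\<^sub>R green_kernel z w"
  have nonneg: "0 \<le> ?f w" for w using green_kernel_nonneg[OF z, of w] by (auto simp: indicator_def)
  have meas: "?f \<in> borel_measurable lebesgue" by (rule measurable_completion) measurable
  have "(\<integral>\<^sup>+w. ennreal (?f w) \<partial>lebesgue) = (\<integral>\<^sup>+w. ennreal (green_kernel z w) * indicator (ball 0 1) w \<partial>lborel)"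
    by (simp add: nn_integral_completion) (intro nn_integral_cong, auto simp: indicator_def)
  also note nn_integral_green_kernel[OF z]
  finally have nn: "(\<integral>\<^sup>+w. ennreal (?f w) \<partial>lebesgue) = ennreal (pi / 2 * (1 - (cmod z)\<^sup>2))" .
  have "0 \<le> pi / 2 * (1 - (cmod z)\<^sup>2)" using z by (auto simp: abs_square_le_1)
  from has_bochner_integral_nn_integral[OF meas AE_I2[OF nonneg] this nn]
  show "set_integrable lebesgue (ball 0 1) (green_kernel z)"
    and "(LINT w:ball 0 1|lebesgue. green_kernel z w) = pi / 2 * (1 - (cmod z)\<^sup>2)"
    unfolding set_integrable_def set_lebesgue_integral_def by (auto simp: has_bochner_integral_iff)
qed

text \<open>The factor 1/4 is the normalisation 1/(2 pi) times pi/2 from the area integral of the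
  nonnegative kernel.\<close>

lemma norm_green_le:
  assumes z: "cmod z < 1" and g: "\<And>w. cmod w < 1 \<Longrightarrow> cmod (g w) \<le> C"
  shows "cmod (green g z) \<le> C / 4 * (1 - (cmod z)\<^sup>2)"
proof -
  have C: "0 \<le> C" using order_trans[OF norm_ge_zero g[of 0]] by simp
  have "cmod (LINT w:ball 0 1|lebesgue. complex_of_real (green_kernel z w) * g w)
     \<le> (\<integral>w. norm (indicator (ball 0 1) w *\<^sub>R (complex_of_real (green_kernel z w) * g w)) \<partial>lebesgue)"
    unfolding set_lebesgue_integral_def by (rule integral_norm_bound)
  also have "\<dots> \<le> (\<integral>w. C * (indicator (ball 0 1) w *\<^sub>R green_kernel z w) \<partial>lebesgue)"
  proof (rule integral_mono')
    show "integrable lebesgue (\<lambda>w. C * (indicator (ball 0 1) w *\<^sub>R green_kernel z w))"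
      using integral_green_kernel(1)[OF z] unfolding set_integrable_def by (rule integrable_mult_right)
    show "0 \<le> C * (indicator (ball 0 1) w *\<^sub>R green_kernel z w)" for w
      using C green_kernel_nonneg[OF z, of w] by (auto simp: indicator_def)
    show "norm (indicator (ball 0 1) w *\<^sub>R (complex_of_real (green_kernel z w) * g w))
        \<le> C * (indicator (ball 0 1) w *\<^sub>R green_kernel z w)" for w
      using g[of w] green_kernel_nonneg[OF z, of w]
      by (auto simp: indicator_def norm_mult mult.commute[of C] intro!: mult_left_mono)
  qed
  also have "\<dots> = C * (pi / 2 * (1 - (cmod z)\<^sup>2))"
    using integral_green_kernel(2)[OF z] unfolding set_lebesgue_integral_def by simp
  finally have "1 / (2 * pi) * cmod (LINT w:ball 0 1|lebesgue. complex_of_real (green_kernel z w) * g w)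
    \<le> 1 / (2 * pi) * (C * (pi / 2 * (1 - (cmod z)\<^sup>2)))" by (rule mult_left_mono) simp
  also have "\<dots> = C / 4 * (1 - (cmod z)\<^sup>2)" by simp
  finally show ?thesis by (simp add: green_def norm_mult norm_divide)
qed

text \<open>For constant data the integral is exact; this produces the extremal example.\<close>

lemma green_const:
  assumes z: "cmod z < 1"
  shows "green (\<lambda>_. c) z = c / 4 * complex_of_real (1 - (cmod z)\<^sup>2)"
proof -
  have "(LINT w:ball 0 1|lebesgue. complex_of_real (green_kernel z w) * c)
    = complex_of_real (LINT w:ball 0 1|lebesgue. green_kernel z w) * c"
    by (simp add: set_integral_mult_left set_integral_complex_of_real)
  then have "green (\<lambda>_. c) z = complex_of_real (1 / (2 * pi) * (pi / 2 * (1 - (cmod z)\<^sup>2))) * c"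
    by (simp only: green_def integral_green_kernel(2)[OF z] of_real_mult mult.assoc)
  also have "1 / (2 * pi) * (pi / 2 * (1 - (cmod z)\<^sup>2)) = (1 - (cmod z)\<^sup>2) / 4" by simp
  finally show ?thesis by simp
qed

section \<open>The Dirichlet problem\<close>

text \<open>The kernel is nonnegative with mean 1. This keeps \<open>poisson \<psi>\<close> bounded
  on the disk, so that its \<open>disk_norm\<close> is a genuine supremum.\<close>

lemma norm_poisson_le:
  assumes "\<And>t. cmod (\<psi> (cis t)) \<le> B" and z: "cmod z < 1"
  shows "cmod (poisson \<psi> z) \<le> B"
proof -
  have "cmod (\<integral>t. complex_of_real (poisson_kernel z (cis t)) * \<psi> (cis t) \<partial>circ)
      \<le> (\<integral>t. cmod (complex_of_real (poisson_kernel z (cis t)) * \<psi> (cis t)) \<partial>circ)"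
    by (rule integral_norm_bound)
  also have "\<dots> \<le> (\<integral>t. B * poisson_kernel z (cis t) \<partial>circ)"
  proof (rule integral_mono')
    show "integrable circ (\<lambda>t. B * poisson_kernel z (cis t))"
      using integral_poisson_kernel(1)[OF z] by simp
    have "0 \<le> B" using order_trans[OF norm_ge_zero assms(1)[of 0]] .
    then show "0 \<le> B * poisson_kernel z (cis t)"
      "cmod (complex_of_real (poisson_kernel z (cis t)) * \<psi> (cis t)) \<le> B * poisson_kernel z (cis t)" for t
      using poisson_kernel_nonneg[OF z] assms(1)[of t] by (auto simp: norm_mult mult.commute[of B] mult_left_mono)
  qed
  also have "\<dots> = B * (2 * pi)" using integral_poisson_kernel(2)[OF z] by simp
  finally have "1 / (2 * pi) * cmod (\<integral>t. complex_of_real (poisson_kernel z (cis t)) * \<psi> (cis t) \<partial>circ) \<le> 1 / (2 * pi) * (B * (2 * pi))"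
    by (rule mult_left_mono) simp
  then show ?thesis by (simp add: poisson_def norm_mult norm_divide integral_circ_eq)
qed

text \<open>B only certifies that the set of values is bounded above; it does not enter the
  conclusion.\<close>

lemma disk_norm_upper:
  assumes "\<And>w. cmod w < 1 \<Longrightarrow> cmod (h w) \<le> B" "cmod z < 1"
  shows "cmod (h z) \<le> disk_norm h"
  unfolding disk_norm_def using assms by (intro cSUP_upper bdd_aboveI2[of _ _ B]) auto

lemma disk_norm_const: "disk_norm (\<lambda>_. c) = cmod c"
  by (simp add: disk_norm_def)

text \<open>Inside the disk the Poisson and Green estimates are added. On the circle the inequality
  holds wherever f has its radial limit as value, by passage to the limit, and almost everywhere by
  the bound on \<open>\<psi>\<close>.\<close>

lemma dirichlet_schwarz:
  assumes g: "continuous_on (cball 0 1) g" and \<psi>: "bounded_boundary_data \<psi>"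
    and f: "dirichlet_solution f g \<psi>"
  shows "\<And>z. cmod z < 1 \<Longrightarrow> schwarz_lhs f \<psi> z \<le> schwarz_rhs \<psi> g z"
    and "\<And>z. \<lbrakk>cmod z = 1; ((\<lambda>r::real. f (r *\<^sub>R z)) \<longlongrightarrow> f z) (at_left 1)\<rbrakk>
           \<Longrightarrow> schwarz_lhs f \<psi> z \<le> schwarz_rhs \<psi> g z"
    and "AE t\<in>{0..2*pi} in lebesgue. schwarz_lhs f \<psi> (cis t) \<le> schwarz_rhs \<psi> g (cis t)"
proof -
  define C where "C = disk_norm (poisson \<psi>)"
  have "bounded (\<psi> ` sphere 0 1)" using \<psi> by (simp add: bounded_boundary_data_def)
  then obtain B where "\<forall>y \<in> \<psi> ` sphere 0 1. cmod y \<le> B" by (metis bounded_iff)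
  then have B: "cmod (\<psi> (cis t)) \<le> B" for t by simp
  have int: "integrable circ (\<lambda>t. \<psi> (cis t))"
    using \<psi> by (simp add: bounded_boundary_data_def integrable_restrict_space set_integrable_def)
  have C: "cmod (poisson \<psi> z) \<le> C" if "cmod z < 1" for z
    unfolding C_def by (rule disk_norm_upper[OF norm_poisson_le[of \<psi> B, OF B] that])
  have ae: "AE t in circ. cmod (\<psi> (cis t)) \<le> C" by (rule AE_boundary_le[of \<psi> B C, OF int B C])
  have "compact (g ` cball 0 1)" by (intro compact_continuous_image g) simp
  then have "bounded (g ` cball 0 1)" by (rule compact_imp_bounded)
  then obtain D where "\<forall>y \<in> g ` cball 0 1. cmod y \<le> D" by (metis bounded_iff)
  then have "cmod (g w) \<le> D" if "cmod w < 1" for w using that by simp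
  then have G: "cmod (g w) \<le> disk_norm g" if "cmod w < 1" for w by (rule disk_norm_upper[OF _ that])
  show inside: "schwarz_lhs f \<psi> z \<le> schwarz_rhs \<psi> g z" if z: "cmod z < 1" for z
  proof -
    have swap: "a - b - c = a - c - b" for a b c :: complex by simp
    have fz: "f z = poisson \<psi> z - green g z" using f z by (simp add: dirichlet_solution_def)
    have "schwarz_lhs f \<psi> z = cmod ((poisson \<psi> z - complex_of_real (1 / (2 * pi) * ((1 - (cmod z)\<^sup>2) / (1 + (cmod z)\<^sup>2))) * (\<integral>t. \<psi> (cis t) \<partial>circ)) - green g z)"
      unfolding schwarz_lhs_def integral_circ_eq fz by (simp only: swap)
    also have "\<dots> \<le> 4 * C / pi * arctan (cmod z) + disk_norm g / 4 * (1 - (cmod z)\<^sup>2)"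
      using norm_triangle_le_diff[OF add_mono[OF poisson_schwarz[OF int ae z] norm_green_le[of z g, OF z G]]] .
    finally show ?thesis by (simp add: schwarz_rhs_def C_def)
  qed
  show "schwarz_lhs f \<psi> z \<le> schwarz_rhs \<psi> g z"
    if z: "cmod z = 1" and lim: "((\<lambda>r::real. f (r *\<^sub>R z)) \<longlongrightarrow> f z) (at_left 1)" for z
  proof (rule tendsto_le)
    have nz: "1 + (1 * cmod z)\<^sup>2 \<noteq> 0" using z by simp
    have id: "((\<lambda>r::real. \<bar>r\<bar> * cmod z) \<longlongrightarrow> 1 * cmod z) (at_left 1)"
      by (intro tendsto_intros) (auto intro!: tendsto_eq_intros)
    show "((\<lambda>r. schwarz_rhs \<psi> g (r *\<^sub>R z)) \<longlongrightarrow> schwarz_rhs \<psi> g z) (at_left 1)"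
      unfolding schwarz_rhs_def norm_scaleR using id by (auto intro!: tendsto_intros)
    show "((\<lambda>r. schwarz_lhs f \<psi> (r *\<^sub>R z)) \<longlongrightarrow> schwarz_lhs f \<psi> z) (at_left 1)"
    proof -
      have "((\<lambda>r. complex_of_real (1 / (2 * pi) * ((1 - (\<bar>r\<bar> * cmod z)\<^sup>2) / (1 + (\<bar>r\<bar> * cmod z)\<^sup>2)))) \<longlongrightarrow>
          complex_of_real (1 / (2 * pi) * ((1 - (1 * cmod z)\<^sup>2) / (1 + (1 * cmod z)\<^sup>2)))) (at_left 1)"
        by (intro tendsto_intros id nz)
      from tendsto_norm[OF tendsto_diff[OF lim tendsto_mult_right[OF this]]] show ?thesis
        unfolding schwarz_lhs_def norm_scaleR mult_1 .
    qed
    show "\<forall>\<^sub>F r in at_left 1. schwarz_lhs f \<psi> (r *\<^sub>R z) \<le> schwarz_rhs \<psi> g (r *\<^sub>R z)"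
      using inside z by (intro eventually_at_leftI[of 0]) auto
  qed simp
  \<comment> \<open>On the circle 1 - |z|^2 vanishes and arctan 1 = pi/4, so with f equal to
    \<open>\<psi>\<close> the claim reduces to the almost everywhere bound by C.\<close>
  have "AE t in lebesgue. t \<in> {0..2*pi} \<longrightarrow> cmod (\<psi> (cis t)) \<le> C"
    using ae by (subst (asm) AE_restrict_space_iff) auto
  moreover have "AE t\<in>{0..2*pi} in lebesgue. f (cis t) = \<psi> (cis t)"
    using f by (simp add: dirichlet_solution_def)
  ultimately show "AE t\<in>{0..2*pi} in lebesgue. schwarz_lhs f \<psi> (cis t) \<le> schwarz_rhs \<psi> g (cis t)"
    by eventually_elim (simp add: schwarz_lhs_def schwarz_rhs_def C_def arctan_one)
qed

section \<open>The paraboloid as extremal example\<close>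

lemma partial_deriv_eqI:
  "((\<lambda>t::real. f (z + t *\<^sub>R v)) has_vector_derivative D) (at 0) \<Longrightarrow> partial_deriv v f z = D"
  by (simp add: partial_deriv_def vector_derivative_at)

text \<open>In coordinates f is c (1 - x^2 - y^2): its first partial derivatives are -2 c x and -2 c
  y, and its second ones are constant.\<close>

lemma
  fixes f :: "complex \<Rightarrow> complex" and c :: real
  assumes f: "\<And>z. f z = complex_of_real (c * (1 - (cmod z)\<^sup>2))"
  shows C2_on_paraboloid: "C2_on S f"
    and laplacian_paraboloid: "laplacian f z = complex_of_real (- 4 * c)"
proof -
  have f': "f z = complex_of_real (c * (1 - ((Re z)\<^sup>2 + (Im z)\<^sup>2)))" for z
    by (simp only: f cmod_power2)
  have d1: "((\<lambda>t::real. f (z + t *\<^sub>R 1)) has_vector_derivative complex_of_real (- 2 * c * Re z)) (at 0)" for z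
    unfolding f'
    by (rule has_vector_derivative_of_real) (auto intro!: derivative_eq_intros)
  have d2: "((\<lambda>t::real. f (z + t *\<^sub>R \<i>)) has_vector_derivative complex_of_real (- 2 * c * Im z)) (at 0)" for z
    unfolding f'
    by (rule has_vector_derivative_of_real) (auto intro!: derivative_eq_intros)
  have p1: "partial_deriv 1 f = (\<lambda>z. complex_of_real (- 2 * c * Re z))"
    and p2: "partial_deriv \<i> f = (\<lambda>z. complex_of_real (- 2 * c * Im z))"
    by (rule ext, rule partial_deriv_eqI, rule d1, rule ext, rule partial_deriv_eqI, rule d2)
  have d: "((\<lambda>t::real. partial_deriv u f (z + t *\<^sub>R v)) has_vector_derivative (if u = v then complex_of_real (- 2 * c) else 0)) (at 0)"
    if "u \<in> {1, \<i>}" "v \<in> {1, \<i>}" for u v z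
    using that unfolding p1 p2
    by (auto simp: p1 p2 intro!: has_vector_derivative_of_real derivative_eq_intros)
  have pp: "partial_deriv v (partial_deriv u f) = (\<lambda>_. if u = v then complex_of_real (- 2 * c) else 0)"
    if "u \<in> {1, \<i>}" "v \<in> {1, \<i>}" for u v
    by (rule ext, rule partial_deriv_eqI, rule d[OF that])
  show "C2_on S f"
    unfolding C2_on_def C1_on_def
  proof (intro conjI ballI)
    fix u v z assume uv: "u \<in> {1, \<i>}" "v \<in> {1, \<i>}"
    show "(\<lambda>t::real. f (z + t *\<^sub>R v)) differentiable at 0"
      using uv d1 d2 by (auto intro: differentiableI_vector)
    show "continuous_on S (partial_deriv v f)"
      using uv by (auto simp: p1 p2 intro!: continuous_intros)
    show "(\<lambda>t::real. partial_deriv u f (z + t *\<^sub>R v)) differentiable at 0"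
      using d[OF uv] by (rule differentiableI_vector)
    show "continuous_on S (partial_deriv v (partial_deriv u f))"
      unfolding pp[OF uv] by (rule continuous_on_const)
  qed
  show "laplacian f z = complex_of_real (- 4 * c)"
    unfolding laplacian_def by (simp add: pp)
qed

text \<open>The function f serves as its own boundary data and vanishes on the circle, so the mean
  and the Poisson part are zero. As the supremum of |g| is 4 M, both sides equal M (1 -
  |z|^2).\<close>

lemma paraboloid_sharp:
  fixes M :: real
  assumes M: "0 < M"
  defines "g \<equiv> \<lambda>z::complex. complex_of_real (- 4 * M)"
    and "f \<equiv> \<lambda>z. complex_of_real (M * (1 - (cmod z)\<^sup>2))"
  shows "bounded_boundary_data f" "dirichlet_solution f g f"
    "\<And>z. z \<in> sphere 0 1 \<union> {0} \<Longrightarrow> schwarz_lhs f f z = schwarz_rhs f g z"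
proof -
  have f_cis: "f (cis t) = 0" for t by (simp add: f_def)
  have poisson: "poisson f = (\<lambda>_. 0)" by (simp add: poisson_def f_cis fun_eq_iff)
  show "bounded_boundary_data f"
    unfolding bounded_boundary_data_def f_cis by (auto simp: f_def set_integrable_def bounded_iff)
  show "dirichlet_solution f g f"
    unfolding dirichlet_solution_def
  proof (intro conjI ballI AE_I2 impI refl)
    have f: "f z = complex_of_real (M * (1 - (cmod z)\<^sup>2))" for z by (simp only: f_def)
    show "C2_on (ball 0 1) f" by (rule C2_on_paraboloid[OF f])
    show "laplacian f z = g z" for z by (simp only: laplacian_paraboloid[OF f] g_def)
    show "f z = poisson f z - green g z" if "z \<in> ball 0 1" for z
      using that by (simp add: poisson g_def green_const f)
  qed
  show "schwarz_lhs f f z = schwarz_rhs f g z" if "z \<in> sphere 0 1 \<union> {0}" for z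
  proof -
    have "schwarz_lhs f f z = cmod (f z)" by (simp add: schwarz_lhs_def f_cis)
    also have "\<dots> = M * \<bar>1 - (cmod z)\<^sup>2\<bar>" unfolding f_def norm_of_real abs_mult using M by simp
    also have "\<dots> = M * (1 - (cmod z)\<^sup>2)" using that by auto
    also have "\<dots> = schwarz_rhs f g z"
      using M unfolding schwarz_rhs_def poisson g_def disk_norm_const norm_of_real by simp
    finally show ?thesis .
  qed
qed

theorem theorem1:
  "(\<forall>f g \<psi> :: complex \<Rightarrow> complex.
      continuous_on (cball 0 1) g \<and> bounded_boundary_data \<psi> \<and> dirichlet_solution f g \<psi> \<longrightarrow>
        (\<forall>z\<in>ball 0 1. schwarz_lhs f \<psi> z \<le> schwarz_rhs \<psi> g z) \<and>
        (\<forall>z\<in>sphere 0 1. ((\<lambda>r::real. f (r *\<^sub>R z)) \<longlongrightarrow> f z) (at_left 1) \<longrightarrow>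
           schwarz_lhs f \<psi> z \<le> schwarz_rhs \<psi> g z) \<and>
        (AE t\<in>{0..2*pi} in lebesgue. schwarz_lhs f \<psi> (cis t) \<le> schwarz_rhs \<psi> g (cis t))) \<and>
   (\<forall>M::real. M > 0 \<longrightarrow>
      (let g = (\<lambda>z. complex_of_real (- 4 * M));
           f = (\<lambda>z. complex_of_real (M * (1 - (cmod z)\<^sup>2)))
       in continuous_on (cball 0 1) g \<and> bounded_boundary_data f \<and> dirichlet_solution f g f \<and>
          (\<forall>z\<in>sphere 0 1 \<union> {0}. schwarz_lhs f f z = schwarz_rhs f g z)))"
proof (rule conjI; intro allI impI)
  fix f g \<psi> :: "complex \<Rightarrow> complex"
  assume A: "continuous_on (cball 0 1) g \<and> bounded_boundary_data \<psi> \<and> dirichlet_solution f g \<psi>"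
  note S = dirichlet_schwarz[OF A[THEN conjunct1] A[THEN conjunct2, THEN conjunct1] A[THEN conjunct2, THEN conjunct2]]
  show "(\<forall>z\<in>ball 0 1. schwarz_lhs f \<psi> z \<le> schwarz_rhs \<psi> g z) \<and>
        (\<forall>z\<in>sphere 0 1. ((\<lambda>r::real. f (r *\<^sub>R z)) \<longlongrightarrow> f z) (at_left 1) \<longrightarrow>
           schwarz_lhs f \<psi> z \<le> schwarz_rhs \<psi> g z) \<and>
        (AE t\<in>{0..2*pi} in lebesgue. schwarz_lhs f \<psi> (cis t) \<le> schwarz_rhs \<psi> g (cis t))"
    using S by (intro conjI ballI impI) (simp_all only: mem_ball_0 mem_sphere_0)
next
  fix M :: real assume M: "M > 0"
  show "let g = (\<lambda>z. complex_of_real (- 4 * M));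
           f = (\<lambda>z. complex_of_real (M * (1 - (cmod z)\<^sup>2)))
       in continuous_on (cball 0 1) g \<and> bounded_boundary_data f \<and> dirichlet_solution f g f \<and>
          (\<forall>z\<in>sphere 0 1 \<union> {0}. schwarz_lhs f f z = schwarz_rhs f g z)"
    unfolding Let_def by (intro conjI ballI paraboloid_sharp[OF M] continuous_on_const)
qed

end
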